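(* Let $f\in C^{0,1}(\Omega\times\mathbb{R},\mathbb{R})$, let $\tau$ be the local skewproduct flow on $\Omega\times\mathbb{R}$ defined by the family $x'=f(\omega\cdot t,x)$, $\omega\in\Omega$, let $m\in\mathfrak{M}_{\mathrm{erg}}(\Omega,\sigma)$, and let $\mathcal{K}\subset\Omega\times\mathbb{R}$ be a compact $\tau$-invariant set projecting onto $\Omega$ whose variation interval $J_{\mathcal{K}}$ does not reduce to a point. Assume that $f$ is $(\mathrm{SDC})_m$ on $J_{\mathcal{K}}$. Then there exist at most three distinct $\tau$-ergodic measures concentrated on $\mathcal{K}$ which project onto $m$.
   Context: $\Omega$ is a compact metric space with a continuous flow $\sigma:\mathbb{R}\times\Omega\to\Omega$, written $\sigma(t,\omega)=\omega\cdot t$. $C^{0,k}(\Omega\times\mathbb{R},\mathbb{R})$ is the set of functions $f:\Omega\times\mathbb{R}\to\mathbb{R}$ such that $f$ and its partial derivatives with respect to $x$ up to order $k$ exist and are jointly continuous. $t\mapsto u(t,\omega,x_0)$ is the maximal solution of $x'=f(\omega\cdot t,x)$ with $u(0,\omega,x_0)=x_0$; the local skewproduct flow is $\tau(t,\omega,x_0)=(\omega\cdot t,u(t,\omega,x_0))$. A set is $\tau$-invariant if it is composed of globally defined $\tau$-orbits. A compact $\tau$-invariant set $\mathcal{K}$ projects onto $\Omega$ if $(\omega,x)\mapsto\omega$ maps $\mathcal{K}$ onto $\Omega$. Its variation interval is $J_{\mathcal{K}}=[\inf_{(\omega,x)\in\mathcal{K}}x,\ \sup_{(\omega,x)\in\mathcal{K}}x]$.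 $\mathfrak{M}_{\mathrm{erg}}(\Omega,\sigma)$ is the set of normalized $\sigma$-ergodic Borel measures on $\Omega$; $\mathfrak{M}_{\mathrm{erg}}(\mathcal{K},\tau)$ is the analogous set for $(\mathcal{K},\tau)$. A measure $\nu\in\mathfrak{M}_{\mathrm{erg}}(\mathcal{K},\tau)$ projects onto $m$ if $m(A)=\nu((A\times\mathbb{R})\cap\mathcal{K})$ for every Borel set $A\subseteq\Omega$. $f\in C^{0,1}(\Omega\times\mathbb{R},\mathbb{R})$ is $(\mathrm{DC})$ (d-concave) if $f_x(\omega,\cdot)$ is concave on $\mathbb{R}$ for all $\omega\in\Omega$. For a (DC) function $f$, a compact nondegenerate interval $J$ of length $l(J)$ and $\epsilon\in[0,l(J)]$, the standardized $\epsilon$-module of d-concavity of $f$ on $J$ is $$b_{J,\epsilon}(\omega)=\frac{\epsilon}{4\,l(J)^2}\min_{x\in J_\epsilon}\{2f_x(\omega,x)-f_x(\omega,x-\epsilon/2)-f_x(\omega,x+\epsilon/2)\},\quad J_\epsilon=\{x\in\mathbb{R}:[x-\epsilon/2,x+\epsilon/2]\subseteq J\}.$$ $f$ is $(\mathrm{SDC})_m$ on $J$ if it is (DC) and there exists $\rho>0$ such that $m(\{\omega\in\Omega: b_{J,\epsilon}(\omega)>0\})>\rho$ for all $\epsilon\in(0,l(J)/2]$. *)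

theory Defs
  imports "HOL-Probability.Probability"
begin

definition continuous_flow :: "(real \<Rightarrow> 'a::topological_space \<Rightarrow> 'a) \<Rightarrow> bool" where
  "continuous_flow \<sigma> \<longleftrightarrow>
     continuous_on UNIV (\<lambda>(t, \<omega>). \<sigma> t \<omega>) \<and>
     (\<forall>\<omega>. \<sigma> 0 \<omega> = \<omega>) \<and>
     (\<forall>s t \<omega>. \<sigma> (s + t) \<omega> = \<sigma> s (\<sigma> t \<omega>))"

definition C0k :: "nat \<Rightarrow> ('a::topological_space \<Rightarrow> real \<Rightarrow> real) \<Rightarrow> bool" where
  "C0k k f \<longleftrightarrow>
     (\<forall>j<k. \<forall>\<omega> x. (deriv ^^ j) (f \<omega>) field_differentiable (at x)) \<and>
     (\<forall>j\<le>k. continuous_on UNIV (\<lambda>(\<omega>, x). (deriv ^^ j) (f \<omega>) x))"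

definition solves_on ::
    "(real \<Rightarrow> 'a \<Rightarrow> 'a) \<Rightarrow> ('a \<Rightarrow> real \<Rightarrow> real) \<Rightarrow> 'a \<Rightarrow> real \<Rightarrow> real set \<Rightarrow> (real \<Rightarrow> real) \<Rightarrow> bool" where
  "solves_on \<sigma> f \<omega> x0 I v \<longleftrightarrow>
     open I \<and> is_interval I \<and> 0 \<in> I \<and> v 0 = x0 \<and>
     (\<forall>t\<in>I. (v has_real_derivative f (\<sigma> t \<omega>) (v t)) (at t))"

text \<open>
  The maximal solution is obtained by gluing together all solutions of the initial value
  problem; they agree where their intervals overlap. The lemmas \<open>max_solution_extends\<close> and
  \<open>max_solution_solves\<close> below justify this. The value of \<open>max_solution\<close> outside
  \<open>max_interval\<close> is irrelevant.
\<close>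

definition max_interval ::
    "(real \<Rightarrow> 'a \<Rightarrow> 'a) \<Rightarrow> ('a \<Rightarrow> real \<Rightarrow> real) \<Rightarrow> 'a \<Rightarrow> real \<Rightarrow> real set" where
  "max_interval \<sigma> f \<omega> x0 = \<Union>{I. \<exists>v. solves_on \<sigma> f \<omega> x0 I v}"

definition max_solution ::
    "(real \<Rightarrow> 'a \<Rightarrow> 'a) \<Rightarrow> ('a \<Rightarrow> real \<Rightarrow> real) \<Rightarrow> real \<Rightarrow> 'a \<Rightarrow> real \<Rightarrow> real" where
  "max_solution \<sigma> f t \<omega> x0 = (THE y. \<exists>I v. solves_on \<sigma> f \<omega> x0 I v \<and> t \<in> I \<and> v t = y)"

definition skewproduct ::
    "(real \<Rightarrow> 'a \<Rightarrow> 'a) \<Rightarrow> ('a \<Rightarrow> real \<Rightarrow> real) \<Rightarrow> real \<Rightarrow> 'a \<times> real \<Rightarrow> 'a \<times> real" where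
  "skewproduct \<sigma> f t = (\<lambda>(\<omega>, x0). (\<sigma> t \<omega>, max_solution \<sigma> f t \<omega> x0))"

definition skewproduct_invariant ::
    "(real \<Rightarrow> 'a \<Rightarrow> 'a) \<Rightarrow> ('a \<Rightarrow> real \<Rightarrow> real) \<Rightarrow> ('a \<times> real) set \<Rightarrow> bool" where
  "skewproduct_invariant \<sigma> f K \<longleftrightarrow>
     (\<forall>(\<omega>, x0)\<in>K. max_interval \<sigma> f \<omega> x0 = UNIV \<and> (\<forall>t. skewproduct \<sigma> f t (\<omega>, x0) \<in> K))"

lemma solves_on_unique:
  assumes \<sigma>: "continuous_flow \<sigma>" and f: "C0k 1 f"
    and v: "solves_on \<sigma> f \<omega> x0 I v" and w: "solves_on \<sigma> f \<omega> x0 J w"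
    and t: "t \<in> I" "t \<in> J"
  shows "v t = w t"
proof -
  define S where "S = closed_segment 0 t"
  have "convex I" "convex J" "0 \<in> I" "0 \<in> J"
    using v w by (simp_all add: solves_on_def is_interval_convex_1)
  then have iv: "S \<subseteq> I" "S \<subseteq> J"
    unfolding S_def using t by (simp_all add: closed_segment_subset)
  have S: "S = {min 0 t..max 0 t}"
    by (auto simp: S_def closed_segment_eq_real_ivl)
  have dv: "(v has_real_derivative f (\<sigma> s \<omega>) (v s)) (at s)"
    and dw: "(w has_real_derivative f (\<sigma> s \<omega>) (w s)) (at s)" if "s \<in> S" for s
    using that iv v w by (auto simp: solves_on_def)
  have "continuous_on S v" "continuous_on S w"
    using DERIV_isCont[OF dv] DERIV_isCont[OF dw] by (simp_all add: continuous_at_imp_continuous_on)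
  then have "bounded (v ` S \<union> w ` S)"
    unfolding S by (intro compact_imp_bounded compact_Un compact_continuous_image compact_Icc)
  then obtain B where B: "\<And>s. s \<in> S \<Longrightarrow> \<bar>v s\<bar> \<le> B \<and> \<bar>w s\<bar> \<le> B"
    unfolding bounded_iff by auto
  have cf: "continuous_on UNIV (\<lambda>(\<omega>, x). deriv (f \<omega>) x)"
    using f unfolding C0k_def by (auto dest: spec[of _ 1])
  have df: "(f \<eta> has_real_derivative deriv (f \<eta>) x) (at x)" for \<eta> x
    using f by (auto simp: C0k_def field_differentiable_derivI)
  have cs: "continuous_on UNIV (\<lambda>(t, \<omega>). \<sigma> t \<omega>)"
    using \<sigma> by (simp add: continuous_flow_def)
  have "continuous_on (S \<times> {-B..B}) (\<lambda>p. (fst p, \<omega>))"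
    by (intro continuous_intros)
  from continuous_on_compose2[OF cs this]
  have "continuous_on (S \<times> {-B..B}) (\<lambda>p. (\<sigma> (fst p) \<omega>, snd p))"
    by (intro continuous_intros) simp_all
  from continuous_on_compose2[OF cf this]
  have "continuous_on (S \<times> {-B..B}) (\<lambda>p. deriv (f (\<sigma> (fst p) \<omega>)) (snd p))"
    by simp
  then have "bounded ((\<lambda>p. deriv (f (\<sigma> (fst p) \<omega>)) (snd p)) ` (S \<times> {-B..B}))"
    unfolding S by (intro compact_imp_bounded compact_continuous_image compact_Times) auto
  then obtain L where L: "\<And>s x. s \<in> S \<Longrightarrow> x \<in> {-B..B} \<Longrightarrow> \<bar>deriv (f (\<sigma> s \<omega>)) x\<bar> \<le> L"
    unfolding bounded_iff by force
  have lip: "\<bar>f (\<sigma> s \<omega>) (v s) - f (\<sigma> s \<omega>) (w s)\<bar> \<le> L * \<bar>v s - w s\<bar>" if s: "s \<in> S" for s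
  proof -
    have "norm (f (\<sigma> s \<omega>) (v s) - f (\<sigma> s \<omega>) (w s)) \<le> L * norm (v s - w s)"
    proof (rule field_differentiable_bound)
      show "convex {-B..B}" by simp
      show "(f (\<sigma> s \<omega>) has_field_derivative deriv (f (\<sigma> s \<omega>)) z) (at z within {-B..B})" for z
        using df by (rule has_field_derivative_at_within)
      show "norm (deriv (f (\<sigma> s \<omega>)) z) \<le> L" if "z \<in> {-B..B}" for z
        using L[OF s that] by simp
      show "v s \<in> {-B..B}" "w s \<in> {-B..B}"
        using B[OF s] by auto
    qed
    then show ?thesis by simp
  qed
  define g where "g s = v s - w s" for s
  define r where "r s = f (\<sigma> s \<omega>) (v s) - f (\<sigma> s \<omega>) (w s)" for s
  have dg: "(g has_real_derivative r s) (at s)" if "s \<in> S" for s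
    unfolding g_def r_def using dv[OF that] dw[OF that] by (auto intro!: derivative_intros)
  have bound: "\<bar>g s * r s\<bar> \<le> L * (g s)\<^sup>2" if "s \<in> S" for s
  proof -
    have "\<bar>g s\<bar> * \<bar>r s\<bar> \<le> \<bar>g s\<bar> * (L * \<bar>g s\<bar>)"
      unfolding g_def r_def by (intro mult_left_mono lip that) simp
    also have "\<dots> = L * \<bar>g s\<bar>\<^sup>2"
      by (simp only: power2_eq_square ac_simps)
    finally show ?thesis by (simp add: abs_mult)
  qed
  have dh: "((\<lambda>s. (g s)\<^sup>2 * exp (c * s)) has_real_derivative
      (2 * (g s * r s) + c * (g s)\<^sup>2) * exp (c * s)) (at s)" if "s \<in> S" for s c
    using dg[OF that] by (auto intro!: derivative_eq_intros simp: algebra_simps power2_eq_square)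
  have g0: "g 0 = 0"
    using v w by (simp add: g_def solves_on_def)
  have "(g t)\<^sup>2 \<le> 0"
  proof (cases "0 \<le> t")
    case True
    have "(g t)\<^sup>2 * exp (- 2 * L * t) \<le> (g 0)\<^sup>2 * exp (- 2 * L * 0)"
    proof (rule DERIV_nonpos_imp_nonincreasing[OF True])
      fix s assume "0 \<le> s" "s \<le> t"
      then have s: "s \<in> S" by (simp add: S)
      have "(2 * (g s * r s) + - 2 * L * (g s)\<^sup>2) * exp (- 2 * L * s) \<le> 0"
        using bound[OF s] by (intro mult_nonpos_nonneg) auto
      then show "\<exists>y. ((\<lambda>s. (g s)\<^sup>2 * exp (- 2 * L * s)) has_real_derivative y) (at s) \<and> y \<le> 0"
        using dh[OF s, of "- 2 * L"] by blast
    qed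
    then show ?thesis by (simp add: g0 mult_le_0_iff)
  next
    case False
    have "(g t)\<^sup>2 * exp (2 * L * t) \<le> (g 0)\<^sup>2 * exp (2 * L * 0)"
    proof (rule DERIV_nonneg_imp_nondecreasing[of t 0])
      show "t \<le> 0" using False by simp
    next
      fix s assume "t \<le> s" "s \<le> 0"
      then have s: "s \<in> S" by (simp add: S)
      have "(2 * (g s * r s) + 2 * L * (g s)\<^sup>2) * exp (2 * L * s) \<ge> 0"
        using bound[OF s] by (intro mult_nonneg_nonneg) auto
      then show "\<exists>y. ((\<lambda>s. (g s)\<^sup>2 * exp (2 * L * s)) has_real_derivative y) (at s) \<and> 0 \<le> y"
        using dh[OF s, of "2 * L"] by blast
    qed
    then show ?thesis by (simp add: g0 mult_le_0_iff)
  qed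
  then show ?thesis by (simp add: g_def)
qed

lemma max_solution_extends:
  assumes "continuous_flow \<sigma>" "C0k 1 f" and v: "solves_on \<sigma> f \<omega> x0 I v"
  shows "I \<subseteq> max_interval \<sigma> f \<omega> x0" "t \<in> I \<Longrightarrow> max_solution \<sigma> f t \<omega> x0 = v t"
proof -
  show "I \<subseteq> max_interval \<sigma> f \<omega> x0"
    using v by (auto simp: max_interval_def)
  show "max_solution \<sigma> f t \<omega> x0 = v t" if "t \<in> I"
    unfolding max_solution_def
  proof (rule the_equality)
    show "\<exists>I' v'. solves_on \<sigma> f \<omega> x0 I' v' \<and> t \<in> I' \<and> v' t = v t"
      using that v by blast
    show "y = v t" if "\<exists>I' v'. solves_on \<sigma> f \<omega> x0 I' v' \<and> t \<in> I' \<and> v' t = y" for y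
      using that solves_on_unique[OF assms(1,2) _ v _ \<open>t \<in> I\<close>] by blast
  qed
qed

lemma max_solution_solves:
  assumes "continuous_flow \<sigma>" "C0k 1 f" and ne: "max_interval \<sigma> f \<omega> x0 \<noteq> {}"
  shows "solves_on \<sigma> f \<omega> x0 (max_interval \<sigma> f \<omega> x0) (\<lambda>t. max_solution \<sigma> f t \<omega> x0)"
proof -
  let ?M = "max_interval \<sigma> f \<omega> x0" and ?u = "\<lambda>t. max_solution \<sigma> f t \<omega> x0"
  note ext = max_solution_extends[OF assms(1,2)]
  have op: "open ?M"
    unfolding max_interval_def by (auto simp: solves_on_def)
  have "connected ?M"
    unfolding max_interval_def
    by (rule connected_Union) (auto simp: solves_on_def is_interval_connected_1)
  moreover obtain I v where v: "solves_on \<sigma> f \<omega> x0 I v"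
    using ne by (auto simp: max_interval_def)
  then have "0 \<in> ?M" "?u 0 = x0"
    using ext[OF v] by (auto simp: solves_on_def)
  moreover have "(?u has_real_derivative f (\<sigma> t \<omega>) (?u t)) (at t)" if t: "t \<in> ?M" for t
  proof -
    obtain I v where v: "solves_on \<sigma> f \<omega> x0 I v" "t \<in> I"
      using t by (auto simp: max_interval_def)
    then have "(v has_real_derivative f (\<sigma> t \<omega>) (?u t)) (at t)" "open I"
      using ext(2)[OF v(1)] by (auto simp: solves_on_def)
    then show ?thesis
      using v(2) by (rule has_field_derivative_transform_within_open) (simp add: ext(2)[OF v(1)])
  qed
  ultimately show ?thesis
    using op by (simp add: solves_on_def is_interval_connected_1)
qed

text \<open>
  The set \<open>ergodic_measures K \<phi>\<close> contains the normalized ergodic Borel measures of the flow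
  \<open>\<phi>\<close> on its phase space \<open>K\<close>. Only the restriction of \<open>\<phi>\<close> to \<open>K\<close> is used; it is meant to
  map \<open>K\<close> into itself. The measures live on \<open>K\<close> with its relative Borel sets, so that two of
  them are equal iff they agree on all Borel subsets of \<open>K\<close>.
\<close>

definition ergodic_measures ::
    "'x::topological_space set \<Rightarrow> (real \<Rightarrow> 'x \<Rightarrow> 'x) \<Rightarrow> 'x measure set" where
  "ergodic_measures K \<phi> =
     {\<nu>. prob_space \<nu> \<and> sets \<nu> = sets (restrict_space borel K) \<and>
         (\<forall>t. \<forall>A\<in>sets \<nu>. emeasure \<nu> (\<phi> t -` A \<inter> K) = emeasure \<nu> A) \<and>
         (\<forall>A\<in>sets \<nu>. (\<forall>t. \<phi> t -` A \<inter> K = A) \<longrightarrow> emeasure \<nu> A = 0 \<or> emeasure \<nu> A = 1)}"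

definition projects_onto ::
    "('a::topological_space \<times> real) set \<Rightarrow> ('a \<times> real) measure \<Rightarrow> 'a measure \<Rightarrow> bool" where
  "projects_onto K \<nu> m \<longleftrightarrow> (\<forall>A\<in>sets borel. emeasure m A = emeasure \<nu> ((A \<times> UNIV) \<inter> K))"

definition variation_interval :: "('a \<times> real) set \<Rightarrow> real set" where
  "variation_interval K = {Inf (snd ` K)..Sup (snd ` K)}"

definition DC :: "('a \<Rightarrow> real \<Rightarrow> real) \<Rightarrow> bool" where
  "DC f \<longleftrightarrow> (\<forall>\<omega>. concave_on UNIV (deriv (f \<omega>)))"

abbreviation interval_length :: "real set \<Rightarrow> real" where
  "interval_length J \<equiv> measure lborel J"

definition shrunk_interval :: "real set \<Rightarrow> real \<Rightarrow> real set" where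
  "shrunk_interval J \<epsilon> = {x. {x - \<epsilon>/2..x + \<epsilon>/2} \<subseteq> J}"

text \<open>
  The minimum is written as an infimum; for a compact interval \<open>J\<close> and \<open>0 \<le> \<epsilon> \<le> l(J)\<close> it is
  attained, since \<open>shrunk_interval J \<epsilon>\<close> is then compact and nonempty and the derivative of \<open>f\<close>
  in \<open>x\<close> is continuous.
\<close>

definition dconcavity_module ::
    "('a \<Rightarrow> real \<Rightarrow> real) \<Rightarrow> real set \<Rightarrow> real \<Rightarrow> 'a \<Rightarrow> real" where
  "dconcavity_module f J \<epsilon> \<omega> =
     \<epsilon> / (4 * (interval_length J)\<^sup>2) *
     (INF x\<in>shrunk_interval J \<epsilon>.
        2 * deriv (f \<omega>) x - deriv (f \<omega>) (x - \<epsilon>/2) - deriv (f \<omega>) (x + \<epsilon>/2))"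

definition SDC :: "'a measure \<Rightarrow> ('a \<Rightarrow> real \<Rightarrow> real) \<Rightarrow> real set \<Rightarrow> bool" where
  "SDC m f J \<longleftrightarrow>
     DC f \<and>
     (\<exists>\<rho>>0. \<forall>\<epsilon>\<in>{0<..interval_length J / 2}.
        measure m {\<omega>. dconcavity_module f J \<epsilon> \<omega> > 0} > \<rho>)"

end

theory Submission
  imports Defs
begin

text \<open>
  The flow preserves the order of the points in each fibre of \<open>K\<close>. This forces an ergodic measure
  that projects onto \<open>m\<close> to be concentrated on the graph of a measurable function \<open>b\<close>
  (\<open>ergodic_measure_on_graph\<close>): the part of \<open>K\<close> where the distribution function of the fibre
  measure is at most \<open>c\<close> is almost invariant and, for \<open>c < 1\<close>, not of full measure, so it is a null
  set by ergodicity, and a fibre measure without such a part is a point mass. The function \<open>b\<close> is an invariant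
  section: \<open>t \<mapsto> b (\<sigma> t \<omega>)\<close> solves the equation for almost every \<open>\<omega>\<close>. Again by ergodicity and
  the preserved order, the sections of two distinct measures are strictly ordered in the same way
  over almost every base point (\<open>section_comparison\<close>).

  Four distinct measures would therefore give four sections \<open>b1 < b2 < b3 < b4\<close>. The logarithm
  of the cross ratio of four ordered solutions has as its derivative a positive multiple of
  the third divided difference of \<open>f\<close>, which is nonpositive because \<open>f\<close> is d-concave
  (\<open>slopes_of_concave_derivative\<close>, \<open>cross_ratio_decreases\<close>). So the cross ratio of the four
  sections is a function on the base that decreases along the flow. Since the flow preserves \<open>m\<close>,
  this function is constant along almost every orbit, and its derivative has to vanish. On
  the other hand, the derivative is negative over each \<open>\<omega>\<close> where the \<open>\<epsilon>\<close>-module of d-concavity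
  is positive and the gap \<open>b3 - b2\<close> is at least \<open>\<epsilon>\<close>. The first condition holds on a set of
  measure greater than \<open>\<rho>\<close> for every small \<open>\<epsilon>\<close>, while the second one fails on a set whose measure
  tends to \<open>0\<close> with \<open>\<epsilon>\<close>, which is a contradiction
  (\<open>no_four_ordered_invariant_sections\<close>).
\<close>

section \<open>Flows and their almost invariant sets\<close>

text \<open>
  One second countable factor is enough for a pair to be Borel measurable: an open set of the
  product is a countable union of open rectangles whose sides in that factor belong to a
  countable basis. It is used with a real number as one of the two components.
\<close>

lemma borel_measurable_Pair_second_countable_snd:
  fixes g :: "'c \<Rightarrow> 'a::topological_space" and h :: "'c \<Rightarrow> 'b::second_countable_topology"
  assumes g[measurable]: "g \<in> M \<rightarrow>\<^sub>M borel" and h[measurable]: "h \<in> M \<rightarrow>\<^sub>M borel"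
  shows "(\<lambda>x. (g x, h x)) \<in> M \<rightarrow>\<^sub>M borel"
proof (rule borel_measurableI)
  fix U :: "('a \<times> 'b) set"
  assume U: "open U"
  obtain B :: "'b set set" where B: "countable B" "topological_basis B"
    using ex_countable_basis by auto
  define W where "W V = \<Union>{W. open W \<and> W \<times> V \<subseteq> U}" for V
  have W: "open (W V)" for V
    unfolding W_def by auto
  have "U = (\<Union>V\<in>B. W V \<times> V)"
  proof (intro equalityI subsetI)
    fix p assume "p \<in> U"
    with U obtain X Y where XY: "open X" "open Y" "p \<in> X \<times> Y" "X \<times> Y \<subseteq> U"
      by (rule open_prod_elim)
    obtain V where V: "V \<in> B" "snd p \<in> V" "V \<subseteq> Y"
      using XY(3) by (auto intro: topological_basisE[OF B(2) XY(2)])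
    then have "X \<times> V \<subseteq> U"
      using XY(4) by blast
    then have "fst p \<in> W V"
      using XY unfolding W_def by auto
    then show "p \<in> (\<Union>V\<in>B. W V \<times> V)"
      using V by (auto simp: mem_Times_iff)
  qed (auto simp: W_def)
  then have "(\<lambda>x. (g x, h x)) -` U \<inter> space M
      = (\<Union>V\<in>B. (g -` W V \<inter> space M) \<inter> (h -` V \<inter> space M))"
    by auto
  also have "\<dots> \<in> sets M"
  proof (rule sets.countable_UN''[OF B(1)])
    fix V assume "V \<in> B"
    then have "open V"
      using B(2) topological_basis_open by blast
    then show "(g -` W V \<inter> space M) \<inter> (h -` V \<inter> space M) \<in> sets M"
      using W[of V] by measurable
  qed
  finally show "(\<lambda>x. (g x, h x)) -` U \<inter> space M \<in> sets M" .
qed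

lemma borel_measurable_Pair_second_countable_fst:
  fixes g :: "'c \<Rightarrow> 'a::second_countable_topology" and h :: "'c \<Rightarrow> 'b::topological_space"
  assumes "g \<in> M \<rightarrow>\<^sub>M borel" and "h \<in> M \<rightarrow>\<^sub>M borel"
  shows "(\<lambda>x. (g x, h x)) \<in> M \<rightarrow>\<^sub>M borel"
proof -
  have "prod.swap \<in> borel \<rightarrow>\<^sub>M (borel :: ('a \<times> 'b) measure)"
    by (intro borel_measurable_continuous_onI continuous_on_swap)
  from measurable_compose[OF borel_measurable_Pair_second_countable_snd[OF assms(2,1)] this]
  show ?thesis by simp
qed

locale flow_on =
  fixes K :: "'x::topological_space set" and \<phi> :: "real \<Rightarrow> 'x \<Rightarrow> 'x"
  assumes flow_in: "p \<in> K \<Longrightarrow> \<phi> t p \<in> K"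
    and flow_zero: "p \<in> K \<Longrightarrow> \<phi> 0 p = p"
    and flow_add: "p \<in> K \<Longrightarrow> \<phi> (s + t) p = \<phi> s (\<phi> t p)"
    and flow_cont: "continuous_on (UNIV \<times> K) (\<lambda>(t, p). \<phi> t p)"
begin

lemma continuous_on_flow: "continuous_on K (\<phi> t)"
  by (rule continuous_on_compose2[OF flow_cont, of K "\<lambda>p. (t, p)", simplified])
    (auto intro!: continuous_intros)

lemma
  assumes "\<nu> \<in> ergodic_measures K \<phi>"
  shows ergodic_prob_space: "prob_space \<nu>"
    and ergodic_sets: "sets \<nu> = sets (restrict_space borel K)"
    and ergodic_space: "space \<nu> = K"
    and ergodic_invariant: "A \<in> sets \<nu> \<Longrightarrow> emeasure \<nu> (\<phi> t -` A \<inter> K) = emeasure \<nu> A"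
    and ergodic_cases: "A \<in> sets \<nu> \<Longrightarrow> (\<And>t. \<phi> t -` A \<inter> K = A) \<Longrightarrow>
          emeasure \<nu> A = 0 \<or> emeasure \<nu> A = 1"
proof -
  show "prob_space \<nu>" and s: "sets \<nu> = sets (restrict_space borel K)"
    and "A \<in> sets \<nu> \<Longrightarrow> emeasure \<nu> (\<phi> t -` A \<inter> K) = emeasure \<nu> A"
    and "A \<in> sets \<nu> \<Longrightarrow> (\<And>t. \<phi> t -` A \<inter> K = A) \<Longrightarrow> emeasure \<nu> A = 0 \<or> emeasure \<nu> A = 1"
    using assms by (auto simp: ergodic_measures_def)
  show "space \<nu> = K"
    using sets_eq_imp_space_eq[OF s] by (simp add: space_restrict_space)
qed

lemma measurable_ergodic:
  assumes \<nu>: "\<nu> \<in> ergodic_measures K \<phi>" and h: "continuous_on K h"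
  shows "h \<in> \<nu> \<rightarrow>\<^sub>M borel"
  using borel_measurable_continuous_on_restrict[OF h]
  by (simp add: measurable_cong_sets[OF ergodic_sets[OF \<nu>] refl])

lemma measurable_flow_pair:
  assumes \<nu>: "\<nu> \<in> ergodic_measures K \<phi>"
  shows "(\<lambda>(t, p). \<phi> t p) \<in> lborel \<Otimes>\<^sub>M \<nu> \<rightarrow>\<^sub>M \<nu>"
proof -
  have "(\<lambda>x. (fst x, snd x)) \<in> lborel \<Otimes>\<^sub>M \<nu> \<rightarrow>\<^sub>M (borel :: (real \<times> 'x) measure)"
    by (intro borel_measurable_Pair_second_countable_fst
        measurable_compose[OF measurable_snd measurable_ergodic[OF \<nu> continuous_on_id]]) simp
  then have id: "(\<lambda>x. x) \<in> lborel \<Otimes>\<^sub>M \<nu> \<rightarrow>\<^sub>M restrict_space borel ((UNIV :: real set) \<times> K)"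
    by (intro measurable_restrict_space2) (auto simp: space_pair_measure ergodic_space[OF \<nu>])
  have "(\<lambda>(t, p). \<phi> t p) \<in> restrict_space borel (UNIV \<times> K) \<rightarrow>\<^sub>M borel"
    by (rule borel_measurable_continuous_on_restrict[OF flow_cont])
  from measurable_compose[OF id this]
  have "(\<lambda>(t, p). \<phi> t p) \<in> lborel \<Otimes>\<^sub>M \<nu> \<rightarrow>\<^sub>M restrict_space borel K"
    by (intro measurable_restrict_space2)
      (auto simp: space_pair_measure ergodic_space[OF \<nu>] flow_in)
  then show ?thesis
    by (simp add: measurable_cong_sets[OF refl ergodic_sets[OF \<nu>]])
qed

lemma measurable_flow:
  assumes \<nu>: "\<nu> \<in> ergodic_measures K \<phi>"
  shows "\<phi> t \<in> \<nu> \<rightarrow>\<^sub>M \<nu>"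
  using measurable_Pair2[OF measurable_flow_pair[OF \<nu>], of t] by simp

lemma AE_flow:
  assumes \<nu>: "\<nu> \<in> ergodic_measures K \<phi>" and P: "AE p in \<nu>. P p"
  shows "AE p in \<nu>. P (\<phi> t p)"
proof -
  obtain N where N: "N \<in> sets \<nu>" "emeasure \<nu> N = 0" "{p\<in>space \<nu>. \<not> P p} \<subseteq> N"
    using P by (auto elim!: AE_E)
  have "emeasure \<nu> (\<phi> t -` N \<inter> space \<nu>) = 0"
    using ergodic_invariant[OF \<nu> N(1)] N(2) by (simp add: ergodic_space[OF \<nu>])
  moreover have "\<phi> t -` N \<inter> space \<nu> \<in> sets \<nu>"
    using measurable_flow[OF \<nu>] N(1) by measurable
  ultimately show ?thesis
    using N(3) flow_in by (intro AE_I[of _ _ "\<phi> t -` N \<inter> space \<nu>"])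
      (auto simp: ergodic_space[OF \<nu>])
qed

text \<open>
  Ergodicity speaks of sets that are invariant at every point. A set \<open>A\<close> that is
  invariant only up to null sets is replaced by the set of the points whose orbit is in \<open>A\<close> at
  almost every time. It is invariant because the Lebesgue measure is invariant under
  translations, and by Fubini's theorem it differs from \<open>A\<close> by a null set.
\<close>

lemma ergodic_almost_invariant:
  assumes \<nu>: "\<nu> \<in> ergodic_measures K \<phi>" and A[measurable]: "A \<in> sets \<nu>"
    and inv: "\<And>t. AE p in \<nu>. \<phi> t p \<in> A \<longleftrightarrow> p \<in> A"
  shows "emeasure \<nu> A = 0 \<or> emeasure \<nu> A = 1"
proof -
  interpret \<nu>: prob_space \<nu> by (rule ergodic_prob_space[OF \<nu>])
  interpret L: pair_sigma_finite lborel \<nu> ..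
  note meas[measurable] = measurable_flow_pair[OF \<nu>]
  define A' where "A' = {p\<in>K. AE t in lborel. \<phi> t p \<in> A}"
  have flow_m[measurable]: "(\<lambda>t. \<phi> t p) \<in> lborel \<rightarrow>\<^sub>M \<nu>" if "p \<in> K" for p
    using measurable_Pair1[OF meas, of p] that by (simp add: ergodic_space[OF \<nu>])
  have "A' = {p\<in>space \<nu>. emeasure lborel {t. (t, p) \<in> {x \<in> space (lborel \<Otimes>\<^sub>M \<nu>). (case x of (t, p) \<Rightarrow> \<phi> t p) \<notin> A}} = 0}"
  proof -
    have "(AE t in lborel. \<phi> t p \<in> A) \<longleftrightarrow> emeasure lborel {t. \<phi> t p \<notin> A} = 0" if "p \<in> K" for p
    proof (subst AE_iff_measurable)
      show "{t. \<phi> t p \<notin> A} \<in> sets lborel"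
        using measurable_sets[OF flow_m[OF that], of "space \<nu> - A"] that flow_in[OF that]
        by (simp add: vimage_def ergodic_space[OF \<nu>])
    qed auto
    then show ?thesis
      by (auto simp: A'_def ergodic_space[OF \<nu>] space_pair_measure)
  qed
  also have "\<dots> \<in> sets \<nu>"
  proof -
    let ?Q = "{x \<in> space (lborel \<Otimes>\<^sub>M \<nu>). (case x of (t, p) \<Rightarrow> \<phi> t p) \<notin> A}"
    have "?Q \<in> sets (lborel \<Otimes>\<^sub>M \<nu>)" by measurable
    then have "(\<lambda>p. emeasure lborel ((\<lambda>t. (t, p)) -` ?Q)) \<in> borel_measurable \<nu>"
      by (rule L.measurable_emeasure_Pair2)
    then have "{p \<in> space \<nu>. emeasure lborel ((\<lambda>t. (t, p)) -` ?Q) = 0} \<in> sets \<nu>"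
      by measurable
    then show ?thesis by (simp add: vimage_def)
  qed
  finally have A'[measurable]: "A' \<in> sets \<nu>" .
  have "\<phi> s -` A' \<inter> K = A'" for s
  proof -
    have shift: "(AE t in lborel. Q (t + s)) \<longleftrightarrow> (AE t in lborel. Q t)"
      if Q: "{t. Q t} \<in> sets lborel" for Q
    proof -
      have "(AE t in lborel. Q t) \<longleftrightarrow> (AE t in distr lborel borel ((+) s). Q t)"
        by (simp only: lborel_distr_plus)
      also have "\<dots> \<longleftrightarrow> (AE t in lborel. Q (s + t))"
        using Q by (subst AE_distr_iff) auto
      finally show ?thesis by (simp add: add.commute)
    qed
    have "\<phi> s p \<in> A' \<longleftrightarrow> p \<in> A'" if p: "p \<in> K" for p
    proof -
      have "{t. \<phi> t p \<in> A} \<in> sets lborel"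
        using measurable_sets[OF flow_m[OF p] A] by (simp add: vimage_def)
      from shift[OF this] have "(AE t in lborel. \<phi> t (\<phi> s p) \<in> A) \<longleftrightarrow> (AE t in lborel. \<phi> t p \<in> A)"
        by (simp only: flow_add[OF p])
      then show ?thesis
        using p flow_in[OF p] by (simp only: A'_def mem_Collect_eq simp_thms)
    qed
    moreover have "A' \<subseteq> K"
      by (auto simp: A'_def)
    ultimately show ?thesis
      by blast
  qed
  with A' have "emeasure \<nu> A' = 0 \<or> emeasure \<nu> A' = 1"
    by (intro ergodic_cases[OF \<nu>])
  moreover have "emeasure \<nu> A' = emeasure \<nu> A"
  proof (rule emeasure_eq_AE)
    have "AE t in lborel. AE p in \<nu>. \<phi> t p \<in> A \<longleftrightarrow> p \<in> A"
      using inv by simp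
    then have "AE p in \<nu>. AE t in lborel. \<phi> t p \<in> A \<longleftrightarrow> p \<in> A"
      by (subst (asm) L.AE_commute) measurable
    then show "AE p in \<nu>. p \<in> A' \<longleftrightarrow> p \<in> A"
    proof (rule AE_mp[OF _ AE_I2, rule_format])
      fix p assume p: "p \<in> space \<nu>" and ae: "AE t in lborel. \<phi> t p \<in> A \<longleftrightarrow> p \<in> A"
      show "p \<in> A' \<longleftrightarrow> p \<in> A"
      proof (cases "p \<in> A")
        case True
        then show ?thesis using ae p by (simp add: A'_def ergodic_space[OF \<nu>])
      next
        case False
        have "p \<notin> A'"
        proof
          assume "p \<in> A'"
          then have "AE t in lborel. \<phi> t p \<in> A" by (simp add: A'_def)
          with ae have "AE t in (lborel :: real measure). False"
            by (rule eventually_elim2) (use False in simp)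
          then show False
            by (simp add: AE_iff_null null_sets_def)
        qed
        with False show ?thesis by simp
      qed
    qed
  qed (use A A' in auto)
  ultimately show ?thesis by simp
qed

end

section \<open>The skewproduct flow on a compact invariant set\<close>

text \<open>
  Gronwall's inequality, for the square of \<open>d\<close> because the absolute value need not be
  differentiable at the zeros of \<open>d\<close>.
\<close>

lemma gronwall_square_forward:
  fixes d :: "real \<Rightarrow> real"
  assumes d: "\<And>s. 0 \<le> s \<Longrightarrow> s \<le> t \<Longrightarrow> (d has_real_derivative d' s) (at s)"
    and bound: "\<And>s. 0 \<le> s \<Longrightarrow> s \<le> t \<Longrightarrow> \<bar>d' s\<bar> \<le> L * \<bar>d s\<bar> + \<eta>"
    and "0 \<le> t" and L: "0 \<le> L"
  shows "(d t)\<^sup>2 \<le> ((d 0)\<^sup>2 + \<eta>\<^sup>2) * exp ((2 * L + 1) * t)"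
proof -
  let ?C = "2 * L + 1"
  have "((d t)\<^sup>2 + \<eta>\<^sup>2) * exp (- ?C * t) \<le> ((d 0)\<^sup>2 + \<eta>\<^sup>2) * exp (- ?C * 0)"
  proof (rule DERIV_nonpos_imp_nonincreasing[OF \<open>0 \<le> t\<close>])
    fix s assume s: "0 \<le> s" "s \<le> t"
    have "2 * (d s * d' s) \<le> 2 * (\<bar>d s\<bar> * \<bar>d' s\<bar>)"
      by (metis abs_ge_self abs_mult mult_left_mono zero_le_numeral)
    also have "\<dots> \<le> 2 * (\<bar>d s\<bar> * (L * \<bar>d s\<bar> + \<eta>))"
      using bound[OF s] by (intro mult_left_mono) auto
    also have "\<dots> = 2 * L * (d s)\<^sup>2 + 2 * \<bar>d s\<bar> * \<eta>"
    proof -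
      have "2 * (a * (L * a + \<eta>)) = 2 * L * a\<^sup>2 + 2 * a * \<eta>" for a
        by (simp add: algebra_simps power2_eq_square)
      from this[of "\<bar>d s\<bar>"] show ?thesis by simp
    qed
    also have "2 * \<bar>d s\<bar> * \<eta> \<le> (d s)\<^sup>2 + \<eta>\<^sup>2"
      using sum_squares_bound[of "\<bar>d s\<bar>" \<eta>] by simp
    finally have "2 * (d s * d' s) \<le> ?C * ((d s)\<^sup>2 + \<eta>\<^sup>2)"
      using mult_nonneg_nonneg[OF L zero_le_power2[of \<eta>]] by (simp add: algebra_simps)
    then have "(2 * (d s * d' s) - ?C * ((d s)\<^sup>2 + \<eta>\<^sup>2)) * exp (- ?C * s) \<le> 0"
      by (intro mult_nonpos_nonneg) auto
    moreover have "((\<lambda>s. ((d s)\<^sup>2 + \<eta>\<^sup>2) * exp (- ?C * s)) has_real_derivative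
        (2 * (d s * d' s) - ?C * ((d s)\<^sup>2 + \<eta>\<^sup>2)) * exp (- ?C * s)) (at s)"
      using d[OF s] by (auto intro!: derivative_eq_intros simp: algebra_simps power2_eq_square)
    ultimately show "\<exists>y. ((\<lambda>s. ((d s)\<^sup>2 + \<eta>\<^sup>2) * exp (- ?C * s)) has_real_derivative y) (at s) \<and> y \<le> 0"
      by blast
  qed
  then have "((d t)\<^sup>2 + \<eta>\<^sup>2) * exp (- ?C * t) * exp (?C * t) \<le> ((d 0)\<^sup>2 + \<eta>\<^sup>2) * exp (?C * t)"
    by (intro mult_right_mono) auto
  also have "((d t)\<^sup>2 + \<eta>\<^sup>2) * exp (- ?C * t) * exp (?C * t) = (d t)\<^sup>2 + \<eta>\<^sup>2"
  proof -
    have "exp (- ?C * t) * exp (?C * t) = 1"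
      by (simp only: exp_add[symmetric] mult_minus_left) simp
    then show ?thesis
      by (simp only: mult.assoc mult_1_right)
  qed
  finally show ?thesis
    using zero_le_power2[of \<eta>] by linarith
qed

lemma gronwall_square:
  fixes d :: "real \<Rightarrow> real"
  assumes d: "\<And>s. \<bar>s\<bar> \<le> \<bar>t\<bar> \<Longrightarrow> (d has_real_derivative d' s) (at s)"
    and bound: "\<And>s. \<bar>s\<bar> \<le> \<bar>t\<bar> \<Longrightarrow> \<bar>d' s\<bar> \<le> L * \<bar>d s\<bar> + \<eta>"
    and L: "0 \<le> L"
  shows "(d t)\<^sup>2 \<le> ((d 0)\<^sup>2 + \<eta>\<^sup>2) * exp ((2 * L + 1) * \<bar>t\<bar>)"
proof (cases "0 \<le> t")
  case True
  then show ?thesis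
    using gronwall_square_forward[of t d d' L \<eta>] assms by simp
next
  case False
  have "((\<lambda>s. d (- s)) has_real_derivative - d' (- s)) (at s)" if "0 \<le> s" "s \<le> - t" for s
    using d[of "- s"] that by (simp add: DERIV_mirror)
  then have "(d (- (- t)))\<^sup>2 \<le> ((d (- 0))\<^sup>2 + \<eta>\<^sup>2) * exp ((2 * L + 1) * (- t))"
    by (rule gronwall_square_forward) (use False bound L in auto)
  then show ?thesis
    using False by simp
qed

locale invariant_compact =
  fixes \<sigma> :: "real \<Rightarrow> 'a::metric_space \<Rightarrow> 'a"
    and f :: "'a \<Rightarrow> real \<Rightarrow> real"
    and K :: "('a \<times> real) set"
  assumes compact_base: "compact (UNIV :: 'a set)"
    and base_flow: "continuous_flow \<sigma>"
    and C1: "C0k 1 f"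
    and compact_K: "compact K"
    and invariant_K: "skewproduct_invariant \<sigma> f K"
begin

abbreviation u :: "real \<Rightarrow> 'a \<Rightarrow> real \<Rightarrow> real" where
  "u t \<omega> x \<equiv> max_solution \<sigma> f t \<omega> x"

lemma base_zero: "\<sigma> 0 \<omega> = \<omega>" and base_add: "\<sigma> (s + t) \<omega> = \<sigma> s (\<sigma> t \<omega>)"
  and base_cont: "continuous_on UNIV (\<lambda>(t, \<omega>). \<sigma> t \<omega>)"
  using base_flow by (auto simp: continuous_flow_def)

lemma f_cont: "continuous_on UNIV (\<lambda>(\<omega>, x). f \<omega> x)"
  and df_cont: "continuous_on UNIV (\<lambda>(\<omega>, x). deriv (f \<omega>) x)"
  and df: "(f \<omega> has_real_derivative deriv (f \<omega>) x) (at x)"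
  using C1 by (auto simp: C0k_def field_differentiable_derivI dest: spec[of _ 0] spec[of _ 1])

lemma solves: "(\<omega>, x) \<in> K \<Longrightarrow> solves_on \<sigma> f \<omega> x UNIV (\<lambda>t. u t \<omega> x)"
  using max_solution_solves[OF base_flow C1, of \<omega> x] invariant_K
  by (auto simp: skewproduct_invariant_def)

lemma
  assumes "(\<omega>, x) \<in> K"
  shows u_zero: "u 0 \<omega> x = x"
    and u_deriv: "((\<lambda>t. u t \<omega> x) has_real_derivative f (\<sigma> s \<omega>) (u s \<omega> x)) (at s)"
    and u_in: "(\<sigma> t \<omega>, u t \<omega> x) \<in> K"
  using solves[OF assms] invariant_K assms
  by (auto simp: solves_on_def skewproduct_invariant_def skewproduct_def)

lemma u_add:
  assumes K: "(\<omega>, x) \<in> K"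
  shows "u (s + t) \<omega> x = u s (\<sigma> t \<omega>) (u t \<omega> x)"
proof -
  have "solves_on \<sigma> f (\<sigma> t \<omega>) (u t \<omega> x) UNIV (\<lambda>s. u (s + t) \<omega> x)"
    unfolding solves_on_def
  proof (intro conjI ballI)
    show "((\<lambda>s. u (s + t) \<omega> x) has_real_derivative f (\<sigma> s (\<sigma> t \<omega>)) (u (s + t) \<omega> x)) (at s)" for s
      using u_deriv[OF K, of "s + t"] by (simp only: DERIV_shift base_add)
  qed auto
  from max_solution_extends(2)[OF base_flow C1 this, of s] show ?thesis
    by simp
qed

text \<open>
  Two solutions cannot change their order, because they would have to meet, and flowing back from
  a common value gives a common initial value.
\<close>

lemma u_strict_mono:
  assumes K: "(\<omega>, x) \<in> K" "(\<omega>, y) \<in> K" and "x < y"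
  shows "u t \<omega> x < u t \<omega> y"
proof (rule ccontr)
  assume "\<not> u t \<omega> x < u t \<omega> y"
  define d where "d s = u s \<omega> y - u s \<omega> x" for s
  have "continuous_on S d" for S
    unfolding d_def using DERIV_isCont[OF u_deriv[OF K(1)]] DERIV_isCont[OF u_deriv[OF K(2)]]
    by (auto intro!: continuous_at_imp_continuous_on continuous_intros)
  moreover have "d 0 > 0" "d t \<le> 0"
    using \<open>\<not> _\<close> \<open>x < y\<close> u_zero[OF K(1)] u_zero[OF K(2)] by (auto simp: d_def)
  ultimately obtain s where "d s = 0"
    using IVT'[of d t 0 0] IVT2'[of d t 0 0] by (metis less_imp_le linear)
  then have "u s \<omega> y = u s \<omega> x"
    by (simp add: d_def)
  then have "u (- s + s) \<omega> y = u (- s + s) \<omega> x"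
    by (simp only: u_add[OF K(1)] u_add[OF K(2)])
  then show False
    using \<open>x < y\<close> u_zero[OF K(1)] u_zero[OF K(2)] by simp
qed

text \<open>
  Two orbits in \<open>K\<close> that start close together stay close together during a bounded time: they
  are in a compact set where \<open>f\<close> is Lipschitz continuous in \<open>x\<close> and where \<open>f\<close> along two nearby
  base orbits is uniformly close, so that Gronwall's inequality applies to their difference.
\<close>

lemma continuous_on_u: "continuous_on (UNIV \<times> K) (\<lambda>(t, \<omega>, x). u t \<omega> x)"
  unfolding continuous_on_sequentially
proof (intro allI ballI impI)
  fix X :: "nat \<Rightarrow> real \<times> 'a \<times> real" and p :: "real \<times> 'a \<times> real"
  assume "p \<in> UNIV \<times> K" and X: "(\<forall>n. X n \<in> UNIV \<times> K) \<and> X \<longlonglongrightarrow> p"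
  then obtain t0 \<omega>0 x0 where p: "p = (t0, \<omega>0, x0)" and K0: "(\<omega>0, x0) \<in> K"
    by (cases p) auto
  define t \<omega> x where "t n = fst (X n)" and "\<omega> n = fst (snd (X n))" and "x n = snd (snd (X n))" for n
  have X_eq: "X n = (t n, \<omega> n, x n)" for n
    by (simp add: t_def \<omega>_def x_def)
  have Kn: "(\<omega> n, x n) \<in> K" for n
    using X by (simp add: X_eq)
  have lim: "t \<longlonglongrightarrow> t0" "\<omega> \<longlonglongrightarrow> \<omega>0" "x \<longlonglongrightarrow> x0"
    using X unfolding t_def \<omega>_def x_def p by (auto intro!: tendsto_eq_intros)
  have "bounded (snd ` K)"
    by (intro compact_imp_bounded compact_continuous_image compact_K continuous_intros)
  then obtain B where B: "\<And>\<omega> y. (\<omega>, y) \<in> K \<Longrightarrow> \<bar>y\<bar> \<le> B"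
    unfolding bounded_iff by force
  define J where "J = {- B..B}"
  have J: "y \<in> J" if "(\<omega>, y) \<in> K" for \<omega> y
    using B[OF that] by (auto simp: J_def)
  have "compact ((\<lambda>(\<omega>, y). deriv (f \<omega>) y) ` (UNIV \<times> J))"
    by (intro compact_continuous_image continuous_on_subset[OF df_cont] compact_Times compact_base)
      (auto simp: J_def)
  then have "bounded ((\<lambda>(\<omega>, y). deriv (f \<omega>) y) ` (UNIV \<times> J))"
    by (rule compact_imp_bounded)
  then obtain L0 where L0: "\<And>\<omega> y. y \<in> J \<Longrightarrow> \<bar>deriv (f \<omega>) y\<bar> \<le> L0"
    unfolding bounded_iff by force
  define L where "L = max 0 L0"
  have L: "\<bar>deriv (f \<omega>) y\<bar> \<le> L" if "y \<in> J" for \<omega> y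
    using L0[OF that, of \<omega>] by (auto simp: L_def)
  have lip: "\<bar>f \<omega> y - f \<omega> z\<bar> \<le> L * \<bar>y - z\<bar>" if "y \<in> J" "z \<in> J" for \<omega> y z
  proof -
    have "norm (f \<omega> y - f \<omega> z) \<le> L * norm (y - z)"
      using L that
      by (intro field_differentiable_bound[of J "f \<omega>" "deriv (f \<omega>)"] has_field_derivative_at_within[OF df])
        (auto simp: J_def)
    then show ?thesis by simp
  qed
  define T where "T = \<bar>t0\<bar> + 1"
  define C where "C = (2 * L + 1) * T"
  have "(\<lambda>n. u (t n) (\<omega> n) (x n) - u (t n) \<omega>0 x0) \<longlonglongrightarrow> 0"
  proof (rule tendstoI)
    fix e :: real assume "e > 0"
    \<comment> \<open>chosen such that Gronwall's bound \<open>(\<eta>\<^sup>2 + \<eta>\<^sup>2) * exp C\<close> is less than \<open>e\<^sup>2\<close>\<close>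
    define \<eta> where "\<eta> = e * exp (- C / 2) / 2"
    have \<eta>: "\<eta> > 0"
      using \<open>e > 0\<close> by (simp add: \<eta>_def)
    let ?F = "\<lambda>(s, \<omega>, y). f (\<sigma> s \<omega>) y" and ?D = "{- T..T} \<times> (UNIV :: 'a set) \<times> J"
    have "continuous_on ?D (\<lambda>q. (\<sigma> (fst q) (fst (snd q)), snd (snd q)))"
      by (intro continuous_intros continuous_on_compose2[OF base_cont, of _ "\<lambda>q. (fst q, fst (snd q))", simplified])
    from continuous_on_compose2[OF f_cont this]
    have "continuous_on ?D ?F"
      by (simp add: case_prod_unfold)
    then have "uniformly_continuous_on ?D ?F"
      by (intro compact_uniformly_continuous compact_Times compact_base) (auto simp: J_def)
    then obtain \<delta> where \<delta>: "\<delta> > 0"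
      "\<And>q q'. q \<in> ?D \<Longrightarrow> q' \<in> ?D \<Longrightarrow> dist q' q < \<delta> \<Longrightarrow> dist (?F q') (?F q) < \<eta>"
      using \<eta> unfolding uniformly_continuous_on_def by meson
    have "\<forall>\<^sub>F n in sequentially. dist (\<omega> n) \<omega>0 < \<delta>" "\<forall>\<^sub>F n in sequentially. dist (t n) t0 < 1"
      "\<forall>\<^sub>F n in sequentially. dist (x n) x0 < \<eta>"
      using tendstoD[OF lim(2) \<delta>(1)] tendstoD[OF lim(1) zero_less_one] tendstoD[OF lim(3) \<eta>] by auto
    then show "\<forall>\<^sub>F n in sequentially. dist (u (t n) (\<omega> n) (x n) - u (t n) \<omega>0 x0) 0 < e"
    proof eventually_elim
      case (elim n)
      define d where "d s = u s (\<omega> n) (x n) - u s \<omega>0 x0" for s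
      have tT: "\<bar>t n\<bar> \<le> T"
        using elim(2) by (auto simp: T_def dist_real_def)
      have "(d (t n))\<^sup>2 \<le> ((d 0)\<^sup>2 + \<eta>\<^sup>2) * exp ((2 * L + 1) * \<bar>t n\<bar>)"
      proof (rule gronwall_square)
        show "(d has_real_derivative
            f (\<sigma> s (\<omega> n)) (u s (\<omega> n) (x n)) - f (\<sigma> s \<omega>0) (u s \<omega>0 x0)) (at s)" for s
          unfolding d_def by (intro derivative_intros u_deriv Kn K0)
        fix s :: real assume "\<bar>s\<bar> \<le> \<bar>t n\<bar>"
        then have s: "s \<in> {- T..T}"
          using tT by auto
        have JJ: "u s (\<omega> n) (x n) \<in> J" "u s \<omega>0 x0 \<in> J"
          using J u_in Kn K0 by blast+
        have "\<bar>f (\<sigma> s (\<omega> n)) (u s (\<omega> n) (x n)) - f (\<sigma> s (\<omega> n)) (u s \<omega>0 x0)\<bar> \<le> L * \<bar>d s\<bar>"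
          unfolding d_def by (rule lip[OF JJ])
        moreover have "\<bar>f (\<sigma> s (\<omega> n)) (u s \<omega>0 x0) - f (\<sigma> s \<omega>0) (u s \<omega>0 x0)\<bar> < \<eta>"
          using \<delta>(2)[of "(s, \<omega>0, u s \<omega>0 x0)" "(s, \<omega> n, u s \<omega>0 x0)"] s JJ elim(1)
          by (simp add: dist_Pair_Pair dist_real_def)
        ultimately show "\<bar>f (\<sigma> s (\<omega> n)) (u s (\<omega> n) (x n)) - f (\<sigma> s \<omega>0) (u s \<omega>0 x0)\<bar> \<le> L * \<bar>d s\<bar> + \<eta>"
          by linarith
      qed (simp add: L_def)
      also have "\<dots> \<le> (\<eta>\<^sup>2 + \<eta>\<^sup>2) * exp C"
      proof (intro mult_mono add_mono order_refl)
        have "\<bar>d 0\<bar> \<le> \<bar>\<eta>\<bar>"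
          using elim(3) \<eta> u_zero[OF Kn] u_zero[OF K0] by (simp add: d_def dist_real_def)
        then show "(d 0)\<^sup>2 \<le> \<eta>\<^sup>2"
          by (simp only: abs_le_square_iff)
        show "exp ((2 * L + 1) * \<bar>t n\<bar>) \<le> exp C"
          using tT by (simp add: C_def L_def mult_left_mono)
      qed auto
      also have "\<dots> = e\<^sup>2 / 2"
      proof -
        have "(exp (- C / 2))\<^sup>2 * exp C = 1"
          by (simp add: power2_eq_square flip: exp_add)
        then show ?thesis
          by (simp add: \<eta>_def power_mult_distrib power_divide algebra_simps)
      qed
      also have "\<dots> < e\<^sup>2"
        using \<open>e > 0\<close> by simp
      finally have "\<bar>d (t n)\<bar>\<^sup>2 < e\<^sup>2"
        by simp
      then have "\<bar>d (t n)\<bar> < e"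
        by (rule power2_less_imp_less) (use \<open>e > 0\<close> in simp)
      then show ?case
        by (simp add: d_def)
    qed
  qed
  moreover have "(\<lambda>n. u (t n) \<omega>0 x0) \<longlonglongrightarrow> u t0 \<omega>0 x0"
    using DERIV_isCont[OF u_deriv[OF K0]] lim(1) by (rule isCont_tendsto_compose)
  ultimately have "(\<lambda>n. u (t n) (\<omega> n) (x n) - u (t n) \<omega>0 x0 + u (t n) \<omega>0 x0) \<longlonglongrightarrow> 0 + u t0 \<omega>0 x0"
    by (rule tendsto_add)
  then show "((\<lambda>(t, \<omega>, x). u t \<omega> x) \<circ> X) \<longlonglongrightarrow> (case p of (t, \<omega>, x) \<Rightarrow> u t \<omega> x)"
    by (simp add: o_def X_eq p)
qed

sublocale base: flow_on UNIV \<sigma>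
  by standard (auto simp: base_zero base_add base_cont)

sublocale flow_on K "skewproduct \<sigma> f"
proof
  fix p s t assume "p \<in> K"
  then show "skewproduct \<sigma> f t p \<in> K" "skewproduct \<sigma> f 0 p = p"
    "skewproduct \<sigma> f (s + t) p = skewproduct \<sigma> f s (skewproduct \<sigma> f t p)"
    by (auto simp: skewproduct_def u_in u_zero u_add base_zero base_add split: prod.splits)
next
  have "continuous_on (UNIV \<times> K) (\<lambda>q. (\<sigma> (fst q) (fst (snd q)), u (fst q) (fst (snd q)) (snd (snd q))))"
    using continuous_on_u
    by (intro continuous_intros continuous_on_compose2[OF base_cont, of _ "\<lambda>q. (fst q, fst (snd q))", simplified])
      (auto simp: case_prod_unfold)
  then show "continuous_on (UNIV \<times> K) (\<lambda>(t, p). skewproduct \<sigma> f t p)"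
    by (simp add: skewproduct_def case_prod_unfold)
qed

lemma compact_flow_above: "compact {p\<in>K. q \<le> u t (fst p) (snd p)}"
proof -
  have "closed (K \<inter> (\<lambda>p. snd (skewproduct \<sigma> f t p)) -` {q..})"
    by (rule continuous_closed_preimage)
      (auto intro!: continuous_on_snd continuous_on_flow compact_imp_closed compact_K)
  then have "compact (K \<inter> (K \<inter> (\<lambda>p. snd (skewproduct \<sigma> f t p)) -` {q..}))"
    by (rule compact_Int_closed[OF compact_K])
  also have "K \<inter> (K \<inter> (\<lambda>p. snd (skewproduct \<sigma> f t p)) -` {q..}) = {p\<in>K. q \<le> u t (fst p) (snd p)}"
    by (auto simp: skewproduct_def split: prod.splits)
  finally show ?thesis .
qed

end

section \<open>Ergodic measures are concentrated on graphs\<close>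

text \<open>
  With \<open>B\<close> the preimage of \<open>A\<close> under a measure preserving map or vice versa, an inclusion up to null
  sets already gives almost invariance.
\<close>

lemma (in finite_measure) AE_iff_of_equal_emeasure:
  assumes AB: "A \<in> sets M" "B \<in> sets M" and sub: "AE x in M. x \<in> A \<longrightarrow> x \<in> B"
    and eq: "emeasure M B \<le> emeasure M A"
  shows "AE x in M. x \<in> A \<longleftrightarrow> x \<in> B"
proof -
  have "emeasure M (A \<inter> B) = emeasure M A"
    by (rule emeasure_eq_AE) (use sub AB in auto)
  then have "emeasure M (B - A \<inter> B) = 0"
    using AB eq by (subst emeasure_Diff) (auto simp: diff_eq_0_iff_ennreal less_top[symmetric])
  then have "AE x in M. x \<notin> B - A \<inter> B"
    using AB by (intro AE_not_in) (auto simp: null_sets_def)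
  with sub show ?thesis
    by eventually_elim auto
qed

locale ergodic_base = invariant_compact \<sigma> f K
  for \<sigma> :: "real \<Rightarrow> 'a::metric_space \<Rightarrow> 'a" and f :: "'a \<Rightarrow> real \<Rightarrow> real" and K +
  fixes m :: "'a measure"
  assumes m: "m \<in> ergodic_measures UNIV \<sigma>"
begin

sublocale base: prob_space m
  by (rule base.ergodic_prob_space[OF m])

lemma sets_m [measurable_cong, simp]: "sets m = sets borel"
  using base.ergodic_sets[OF m] by (simp add: sets_restrict_space)

lemma space_m [simp]: "space m = UNIV"
  by (rule base.ergodic_space[OF m])

lemma base_measurable [measurable]: "\<sigma> t \<in> borel \<rightarrow>\<^sub>M borel"
  using base.measurable_flow[OF m, of t] by (simp cong: measurable_cong_sets)

lemma emeasure_base_flow: "A \<in> sets borel \<Longrightarrow> emeasure m (\<sigma> t -` A) = emeasure m A"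
  using base.ergodic_invariant[OF m, of A t] by simp

end

locale projected_ergodic = ergodic_base \<sigma> f K m
  for \<sigma> :: "real \<Rightarrow> 'a::metric_space \<Rightarrow> 'a" and f :: "'a \<Rightarrow> real \<Rightarrow> real" and K and m +
  fixes \<nu> :: "('a \<times> real) measure"
  assumes \<nu>: "\<nu> \<in> ergodic_measures K (skewproduct \<sigma> f)"
    and proj: "projects_onto K \<nu> m"
begin

sublocale prob_space \<nu>
  by (rule ergodic_prob_space[OF \<nu>])

lemma space_\<nu> [simp]: "space \<nu> = K"
  by (rule ergodic_space[OF \<nu>])

lemma fst_measurable [measurable]: "fst \<in> \<nu> \<rightarrow>\<^sub>M borel"
  by (rule measurable_ergodic[OF \<nu> continuous_on_fst[OF continuous_on_id]])

lemma fst_measurable_m: "fst \<in> \<nu> \<rightarrow>\<^sub>M m"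
  using fst_measurable by (simp cong: measurable_cong_sets)

lemma snd_measurable [measurable]: "snd \<in> \<nu> \<rightarrow>\<^sub>M borel"
  by (rule measurable_ergodic[OF \<nu> continuous_on_snd[OF continuous_on_id]])

lemma flow_measurable [measurable]: "skewproduct \<sigma> f t \<in> \<nu> \<rightarrow>\<^sub>M \<nu>"
  by (rule measurable_flow[OF \<nu>])

lemma emeasure_fst: "A \<in> sets borel \<Longrightarrow> emeasure \<nu> {p\<in>K. fst p \<in> A} = emeasure m A"
proof -
  assume "A \<in> sets borel"
  moreover have "{p\<in>K. fst p \<in> A} = (A \<times> UNIV) \<inter> K"
    by (auto simp: mem_Times_iff)
  ultimately show ?thesis
    using proj by (simp add: projects_onto_def)
qed

lemma distr_fst: "distr \<nu> m fst = m"
proof (rule measure_eqI)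
  fix A assume "A \<in> sets (distr \<nu> m fst)"
  then have A: "A \<in> sets borel" by simp
  have "fst -` A \<inter> K = {p\<in>K. fst p \<in> A}"
    by auto
  then show "emeasure (distr \<nu> m fst) A = emeasure m A"
    using A emeasure_fst[OF A] by (simp add: emeasure_distr[OF fst_measurable_m])
qed simp

lemma AE_fst: "AE \<omega> in m. P \<omega> \<Longrightarrow> AE p in \<nu>. P (fst p)"
  using AE_distrD[OF fst_measurable_m, of P] unfolding distr_fst .

lemma AE_fst_iff: "Measurable.pred borel P \<Longrightarrow> (AE p in \<nu>. P (fst p)) \<longleftrightarrow> (AE \<omega> in m. P \<omega>)"
  using AE_distr_iff[OF fst_measurable_m, of P] unfolding distr_fst by (simp add: pred_def)

text \<open>
  \<open>F q \<omega>\<close> is the mass below \<open>q\<close> of the fibre measure over \<open>\<omega>\<close>, obtained without a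
  disintegration of \<open>\<nu>\<close>: a Radon-Nikodym density suffices, for one \<open>q\<close> at a time.
\<close>

lemma fibre_distribution_exists:
  obtains F :: "real \<Rightarrow> 'a \<Rightarrow> ennreal"
  where "\<And>q. F q \<in> borel_measurable borel"
    and "\<And>q A. A \<in> sets borel \<Longrightarrow>
      emeasure \<nu> {p\<in>K. snd p < q \<and> fst p \<in> A} = (\<integral>\<^sup>+\<omega>\<in>A. F q \<omega> \<partial>m)"
proof -
  have "\<exists>F. F \<in> borel_measurable borel \<and> (\<forall>A\<in>sets borel.
      emeasure \<nu> {p\<in>K. snd p < q \<and> fst p \<in> A} = (\<integral>\<^sup>+\<omega>\<in>A. F \<omega> \<partial>m))" for q
  proof -
    define B where "B = {p\<in>space \<nu>. snd p < q}"
    have B: "B \<in> sets \<nu>"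
      unfolding B_def by measurable
    define N where "N = distr (restrict_space \<nu> B) m fst"
    have N: "emeasure N A = emeasure \<nu> {p\<in>K. snd p < q \<and> fst p \<in> A}" if "A \<in> sets borel" for A
    proof -
      have "emeasure N A = emeasure (restrict_space \<nu> B) (fst -` A \<inter> B)"
        using that sets.sets_into_space[OF B] unfolding N_def
        by (subst emeasure_distr) (auto intro!: measurable_restrict_space1 fst_measurable_m simp: space_restrict_space Int_absorb2 inf.absorb1)
      also have "\<dots> = emeasure \<nu> (fst -` A \<inter> B)"
        using B sets.sets_into_space[OF B] by (intro emeasure_restrict_space) (auto simp: Int_absorb2)
      also have "fst -` A \<inter> B = {p\<in>K. snd p < q \<and> fst p \<in> A}"
        by (auto simp: B_def)
      finally show ?thesis .
    qed
    have setsN: "sets N = sets m"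
      by (simp add: N_def)
    have "absolutely_continuous m N"
      unfolding absolutely_continuous_def
    proof
      fix A assume A: "A \<in> null_sets m"
      then have "A \<in> sets borel" and 0: "emeasure \<nu> {p\<in>K. fst p \<in> A} = 0"
        by (auto simp: null_sets_def emeasure_fst)
      have "{p\<in>space \<nu>. fst p \<in> A} \<in> sets \<nu>"
        using \<open>A \<in> sets borel\<close> by measurable
      then have "emeasure N A \<le> emeasure \<nu> {p\<in>K. fst p \<in> A}"
        unfolding N[OF \<open>A \<in> sets borel\<close>] by (intro emeasure_mono) auto
      with 0 show "A \<in> null_sets N"
        using A setsN by (auto simp: null_sets_def)
    qed
    then have D: "density m (RN_deriv m N) = N"
      using setsN by (rule base.density_RN_deriv)
    have R: "RN_deriv m N \<in> borel_measurable m"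
      by (rule borel_measurable_RN_deriv)
    have "emeasure N A = (\<integral>\<^sup>+\<omega>\<in>A. RN_deriv m N \<omega> \<partial>m)" if "A \<in> sets borel" for A
      using emeasure_density[OF R, of A] that by (simp add: D)
    then show ?thesis
      using R N by (intro exI[of _ "RN_deriv m N"]) auto
  qed
  then obtain F where "\<forall>q. F q \<in> borel_measurable borel \<and> (\<forall>A\<in>sets borel.
      emeasure \<nu> {p\<in>K. snd p < q \<and> fst p \<in> A} = (\<integral>\<^sup>+\<omega>\<in>A. F q \<omega> \<partial>m))"
    using choice[of "\<lambda>q F. F \<in> borel_measurable borel \<and> (\<forall>A\<in>sets borel.
      emeasure \<nu> {p\<in>K. snd p < q \<and> fst p \<in> A} = (\<integral>\<^sup>+\<omega>\<in>A. F \<omega> \<partial>m))"] by blast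
  then show thesis
    by (intro that[of F]) auto
qed

text \<open>
  The level set of \<open>c\<close> is the union over \<open>q\<close> of the sets of the \<open>(\<omega>, x)\<close> with \<open>x < q\<close> and
  \<open>F q \<omega> \<le> c\<close>. In each fibre they are nested. So a finite union is, over the part of the base
  where a given \<open>q\<close> is the largest index with \<open>F q \<omega> \<le> c\<close>, just the set of the \<open>x < q\<close>.
\<close>

lemma emeasure_finite_levels_le:
  fixes F :: "real \<Rightarrow> 'a \<Rightarrow> ennreal"
  assumes F[measurable]: "\<And>q. F q \<in> borel_measurable borel"
    and mass: "\<And>q A. A \<in> sets borel \<Longrightarrow>
      emeasure \<nu> {p\<in>K. snd p < q \<and> fst p \<in> A} = (\<integral>\<^sup>+\<omega>\<in>A. F q \<omega> \<partial>m)"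
    and "finite Q" and "A \<in> sets borel"
  shows "emeasure \<nu> {p\<in>K. fst p \<in> A \<and> (\<exists>q\<in>Q. snd p < q \<and> F q (fst p) \<le> c)} \<le> c * emeasure m A"
  using \<open>finite Q\<close> \<open>A \<in> sets borel\<close>
proof (induction Q arbitrary: A rule: finite_linorder_max_induct)
  case empty
  then show ?case by simp
next
  case (insert q Q)
  note [measurable] = \<open>A \<in> sets borel\<close>
  note countable_finite[OF \<open>finite Q\<close>, measurable]
  define A1 where "A1 = {\<omega>\<in>A. F q \<omega> \<le> c}"
  define A2 where "A2 = {\<omega>\<in>A. \<not> F q \<omega> \<le> c}"
  have A1[measurable]: "A1 \<in> sets borel" and A2[measurable]: "A2 \<in> sets borel"
    unfolding A1_def A2_def by measurable
  let ?B1 = "{p\<in>K. snd p < q \<and> fst p \<in> A1}"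
    and ?B2 = "{p\<in>K. fst p \<in> A2 \<and> (\<exists>q\<in>Q. snd p < q \<and> F q (fst p) \<le> c)}"
  have "{p\<in>space \<nu>. snd p < q \<and> fst p \<in> A1} \<in> sets \<nu>"
    "{p\<in>space \<nu>. fst p \<in> A2 \<and> (\<exists>q\<in>Q. snd p < q \<and> F q (fst p) \<le> c)} \<in> sets \<nu>"
    by measurable
  then have B: "?B1 \<in> sets \<nu>" "?B2 \<in> sets \<nu>"
    by simp_all
  have "{p\<in>K. fst p \<in> A \<and> (\<exists>q\<in>insert q Q. snd p < q \<and> F q (fst p) \<le> c)} \<subseteq> ?B1 \<union> ?B2"
  proof
    fix p assume p: "p \<in> {p\<in>K. fst p \<in> A \<and> (\<exists>q\<in>insert q Q. snd p < q \<and> F q (fst p) \<le> c)}"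
    show "p \<in> ?B1 \<union> ?B2"
    proof (cases "fst p \<in> A1")
      case True
      then show ?thesis
        using p insert.hyps by force
    next
      case False
      then show ?thesis
        using p by (auto simp: A1_def A2_def)
    qed
  qed
  then have "emeasure \<nu> {p\<in>K. fst p \<in> A \<and> (\<exists>q\<in>insert q Q. snd p < q \<and> F q (fst p) \<le> c)}
      \<le> emeasure \<nu> (?B1 \<union> ?B2)"
    using B by (intro emeasure_mono) auto
  also have "\<dots> \<le> emeasure \<nu> ?B1 + emeasure \<nu> ?B2"
    using B by (rule emeasure_subadditive)
  also have "\<dots> \<le> c * emeasure m A1 + c * emeasure m A2"
  proof (rule add_mono)
    have "emeasure \<nu> ?B1 \<le> (\<integral>\<^sup>+\<omega>. c * indicator A1 \<omega> \<partial>m)"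
      unfolding mass[OF A1] by (intro nn_integral_mono) (auto simp: A1_def split: split_indicator)
    then show "emeasure \<nu> ?B1 \<le> c * emeasure m A1"
      by (simp add: nn_integral_cmult_indicator)
    show "emeasure \<nu> ?B2 \<le> c * emeasure m A2"
      by (rule insert.IH[OF A2])
  qed
  also have "\<dots> = c * emeasure m A"
  proof -
    have "A1 \<union> A2 = A" "A1 \<inter> A2 = {}"
      by (auto simp: A1_def A2_def)
    then show ?thesis
      using plus_emeasure[of A1 m A2] by (simp flip: distrib_left)
  qed
  finally show ?case .
qed

text \<open>
  The rational \<open>r\<close> can be found because the points of the fibre that the flow maps to \<open>q\<close> or above
  form a compact set, all of it to the right of \<open>x\<close>. Rational levels are needed in order to leave
  out only countably many null sets.
\<close>

lemma rational_above:
  assumes "(\<omega>, x) \<in> K" and "u t \<omega> x < q"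
  obtains r where "r \<in> \<rat>" "x < r" "\<And>y. (\<omega>, y) \<in> K \<Longrightarrow> y \<le> r \<Longrightarrow> u t \<omega> y < q"
proof -
  define C where "C = {p\<in>K. q \<le> u t (fst p) (snd p)} \<inter> {\<omega>} \<times> UNIV"
  have "compact C"
    unfolding C_def by (intro compact_Int_closed compact_flow_above closed_Times) auto
  then have cC: "compact (snd ` C)"
    by (intro compact_continuous_image continuous_intros)
  have above: "x < y" if "y \<in> snd ` C" for y
  proof (rule ccontr)
    assume "\<not> x < y"
    moreover have "(\<omega>, y) \<in> K" "q \<le> u t \<omega> y"
      using that by (auto simp: C_def)
    ultimately show False
      using u_strict_mono[of \<omega> y x t] assms by (cases "y = x") auto
  qed
  have "\<exists>z>x. \<forall>y\<in>snd ` C. z \<le> y"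
  proof (cases "C = {}")
    case True
    then show ?thesis by (auto intro: exI[of _ "x + 1"])
  next
    case False
    then show ?thesis
      using compact_attains_inf[OF cC] above by blast
  qed
  then obtain z where z: "x < z" "\<And>y. y \<in> snd ` C \<Longrightarrow> z \<le> y"
    by auto
  obtain r where r: "r \<in> \<rat>" "x < r" "r < z"
    using Rats_dense_in_real[OF z(1)] by auto
  show thesis
  proof (rule that[OF r(1,2)])
    fix y assume y: "(\<omega>, y) \<in> K" "y \<le> r"
    show "u t \<omega> y < q"
    proof (rule ccontr)
      assume "\<not> u t \<omega> y < q"
      then have "(\<omega>, y) \<in> C"
        using y by (auto simp: C_def)
      then have "z \<le> y"
        using z(2) by force
      with y r show False by simp
    qed
  qed
qed

text \<open>
  The level sets are almost invariant: because the flow preserves the measure and the order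
  in the fibres, it transports the fibre distributions. If a point is mapped below \<open>q\<close>, then so
  are the points of its fibre below some rational \<open>r\<close> to its right; where that happens for a
  given \<open>r\<close>, the mass below \<open>r\<close> is at most the mass below \<open>q\<close> over the image.
\<close>

lemma levels_almost_invariant:
  fixes F :: "real \<Rightarrow> 'a \<Rightarrow> ennreal"
  assumes F[measurable]: "\<And>q. F q \<in> borel_measurable borel"
    and mass: "\<And>q A. A \<in> sets borel \<Longrightarrow>
      emeasure \<nu> {p\<in>K. snd p < q \<and> fst p \<in> A} = (\<integral>\<^sup>+\<omega>\<in>A. F q \<omega> \<partial>m)"
    and "c < top"
  defines "S \<equiv> {p\<in>K. \<exists>q\<in>\<rat>. snd p < q \<and> F q (fst p) \<le> c}"
  shows "AE p in \<nu>. skewproduct \<sigma> f t p \<in> S \<longleftrightarrow> p \<in> S"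
proof -
  note countable_rat[measurable]
  have "{p\<in>space \<nu>. \<exists>q\<in>\<rat>. snd p < q \<and> F q (fst p) \<le> c} \<in> sets \<nu>"
    by measurable
  then have S[measurable]: "S \<in> sets \<nu>"
    by (simp add: S_def)
  have null: "AE \<omega> in m. (\<forall>y. (\<omega>, y) \<in> K \<longrightarrow> y \<le> r \<longrightarrow> u t \<omega> y < q) \<longrightarrow> F q (\<sigma> t \<omega>) \<le> c \<longrightarrow> F r \<omega> \<le> c" for r q
  proof -
    let ?C = "{p\<in>K. q \<le> u t (fst p) (snd p)} \<inter> UNIV \<times> {..r}"
    have "compact (fst ` ?C)"
      by (intro compact_continuous_image continuous_intros compact_Int_closed compact_flow_above closed_Times)
    then have "- fst ` ?C \<in> sets borel"
      by (intro borel_comp borel_closed compact_imp_closed)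
    also have "- fst ` ?C = {\<omega>. \<forall>y. (\<omega>, y) \<in> K \<longrightarrow> y \<le> r \<longrightarrow> u t \<omega> y < q}"
      by force
    finally have B[measurable]: "{\<omega>. \<forall>y. (\<omega>, y) \<in> K \<longrightarrow> y \<le> r \<longrightarrow> u t \<omega> y < q} \<in> sets borel" .
    define A where "A = {\<omega>. \<forall>y. (\<omega>, y) \<in> K \<longrightarrow> y \<le> r \<longrightarrow> u t \<omega> y < q} \<inter> {\<omega>. F q (\<sigma> t \<omega>) \<le> c \<and> \<not> F r \<omega> \<le> c}"
    have A[measurable]: "A \<in> sets borel"
      unfolding A_def by (rule sets.Int[OF B]) measurable
    define A' where "A' = \<sigma> (- t) -` A"
    have A'[measurable]: "A' \<in> sets borel"
      using measurable_sets[OF base_measurable A] by (simp add: A'_def)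
    have "(\<integral>\<^sup>+\<omega>\<in>A. F r \<omega> \<partial>m) = emeasure \<nu> {p\<in>K. snd p < r \<and> fst p \<in> A}"
      by (simp add: mass)
    also have "\<dots> \<le> emeasure \<nu> (skewproduct \<sigma> f t -` {p\<in>K. snd p < q \<and> fst p \<in> A'} \<inter> K)"
    proof (rule emeasure_mono)
      have "{p\<in>space \<nu>. snd p < q \<and> fst p \<in> A'} \<in> sets \<nu>"
        by measurable
      from measurable_sets[OF flow_measurable this]
      show "skewproduct \<sigma> f t -` {p\<in>K. snd p < q \<and> fst p \<in> A'} \<inter> K \<in> sets \<nu>"
        by simp
      show "{p\<in>K. snd p < r \<and> fst p \<in> A} \<subseteq> skewproduct \<sigma> f t -` {p\<in>K. snd p < q \<and> fst p \<in> A'} \<inter> K"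
        by (auto simp: A_def A'_def skewproduct_def u_in base_add[symmetric] base_zero)
    qed
    also have "\<dots> = emeasure \<nu> {p\<in>K. snd p < q \<and> fst p \<in> A'}"
    proof (rule ergodic_invariant[OF \<nu>])
      have "{p\<in>space \<nu>. snd p < q \<and> fst p \<in> A'} \<in> sets \<nu>"
        by measurable
      then show "{p\<in>K. snd p < q \<and> fst p \<in> A'} \<in> sets \<nu>"
        by simp
    qed
    also have "\<dots> = (\<integral>\<^sup>+\<omega>\<in>A'. F q \<omega> \<partial>m)"
      by (simp add: mass)
    also have "\<dots> \<le> (\<integral>\<^sup>+\<omega>. c * indicator A' \<omega> \<partial>m)"
      by (intro nn_integral_mono)
        (auto simp: A_def A'_def base_add[symmetric] base_zero split: split_indicator)
    also have "\<dots> = c * emeasure m A'"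
      by (simp add: nn_integral_cmult_indicator)
    also have "\<dots> = c * emeasure m A"
      by (simp add: A'_def emeasure_base_flow)
    also have "\<dots> = (\<integral>\<^sup>+\<omega>. c * indicator A \<omega> \<partial>m)"
      by (simp add: nn_integral_cmult_indicator)
    finally have le: "(\<integral>\<^sup>+\<omega>\<in>A. F r \<omega> \<partial>m) \<le> (\<integral>\<^sup>+\<omega>. c * indicator A \<omega> \<partial>m)" .
    have "AE \<omega> in m. F r \<omega> * indicator A \<omega> \<le> c * indicator A \<omega>"
    proof (rule ccontr)
      assume "\<not> (AE \<omega> in m. F r \<omega> * indicator A \<omega> \<le> c * indicator A \<omega>)"
      then have "(\<integral>\<^sup>+\<omega>. c * indicator A \<omega> \<partial>m) < (\<integral>\<^sup>+\<omega>\<in>A. F r \<omega> \<partial>m)"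
      proof (rule nn_integral_less[rotated -1])
        have "c * emeasure m A < top"
          unfolding ennreal_mult_less_top using \<open>c < top\<close> by (simp add: less_top[symmetric])
        then show "(\<integral>\<^sup>+\<omega>. c * indicator A \<omega> \<partial>m) \<noteq> \<infinity>"
          by (simp add: nn_integral_cmult_indicator)
        show "AE \<omega> in m. c * indicator A \<omega> \<le> F r \<omega> * indicator A \<omega>"
          by (intro AE_I2) (auto simp: A_def split: split_indicator)
      qed measurable
      with le show False by simp
    qed
    then show ?thesis
      by eventually_elim (auto simp: A_def split: split_indicator_asm)
  qed
  have "AE \<omega> in m. \<forall>r\<in>\<rat>. \<forall>q\<in>\<rat>. (\<forall>y. (\<omega>, y) \<in> K \<longrightarrow> y \<le> r \<longrightarrow> u t \<omega> y < q)
      \<longrightarrow> F q (\<sigma> t \<omega>) \<le> c \<longrightarrow> F r \<omega> \<le> c"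
    by (intro AE_ball_countable[THEN iffD2] ballI countable_rat null)
  then have "AE p in \<nu>. \<forall>r\<in>\<rat>. \<forall>q\<in>\<rat>. (\<forall>y. (fst p, y) \<in> K \<longrightarrow> y \<le> r \<longrightarrow> u t (fst p) y < q)
      \<longrightarrow> F q (\<sigma> t (fst p)) \<le> c \<longrightarrow> F r (fst p) \<le> c"
    by (rule AE_fst)
  then have "AE p in \<nu>. p \<in> skewproduct \<sigma> f t -` S \<inter> K \<longrightarrow> p \<in> S"
  proof eventually_elim
    case (elim p)
    obtain \<omega> x where [simp]: "p = (\<omega>, x)"
      by (cases p)
    show ?case
    proof
      assume "p \<in> skewproduct \<sigma> f t -` S \<inter> K"
      then have p: "skewproduct \<sigma> f t (\<omega>, x) \<in> S" "(\<omega>, x) \<in> K"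
        by auto
      obtain q where q: "q \<in> \<rat>" "u t \<omega> x < q" "F q (\<sigma> t \<omega>) \<le> c"
        using p(1) by (auto simp: S_def skewproduct_def)
      obtain r where "r \<in> \<rat>" "x < r" "\<And>y. (\<omega>, y) \<in> K \<Longrightarrow> y \<le> r \<Longrightarrow> u t \<omega> y < q"
        using rational_above[OF p(2) q(2)] by blast
      with elim q p(2) show "p \<in> S"
        by (auto simp: S_def)
    qed
  qed
  then have "AE p in \<nu>. p \<in> skewproduct \<sigma> f t -` S \<inter> K \<longleftrightarrow> p \<in> S"
    using measurable_sets[OF flow_measurable S] ergodic_invariant[OF \<nu> S, of t]
    by (intro AE_iff_of_equal_emeasure) auto
  then show ?thesis
    by (rule AE_mp) (rule AE_I2, simp)
qed

text \<open>
  Along the finite unions the measure increases to that of the whole level set, which is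
  therefore at most \<open>c\<close>; ergodicity leaves only the value \<open>0\<close>.
\<close>

lemma levels_null:
  fixes F :: "real \<Rightarrow> 'a \<Rightarrow> ennreal"
  assumes F[measurable]: "\<And>q. F q \<in> borel_measurable borel"
    and mass: "\<And>q A. A \<in> sets borel \<Longrightarrow>
      emeasure \<nu> {p\<in>K. snd p < q \<and> fst p \<in> A} = (\<integral>\<^sup>+\<omega>\<in>A. F q \<omega> \<partial>m)"
    and "c < 1"
  shows "AE p in \<nu>. \<forall>q\<in>\<rat>. snd p < q \<longrightarrow> c < F q (fst p)"
proof -
  note countable_rat[measurable]
  define S where "S = {p\<in>K. \<exists>q\<in>\<rat>. snd p < q \<and> F q (fst p) \<le> c}"
  define Q where "Q n = from_nat_into (\<rat> :: real set) ` {..n}" for n :: nat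
  define S' where "S' n = {p\<in>K. fst p \<in> UNIV \<and> (\<exists>q\<in>Q n. snd p < q \<and> F q (fst p) \<le> c)}" for n
  have Rats: "(\<rat> :: real set) = (\<Union>n. Q n)"
    unfolding Q_def using range_from_nat_into[OF _ countable_rat]
    by (metis Rats_0 UN_atMost_UNIV empty_iff image_UN)
  have "{p\<in>space \<nu>. \<exists>q\<in>\<rat>. snd p < q \<and> F q (fst p) \<le> c} \<in> sets \<nu>"
    by measurable
  then have S: "S \<in> sets \<nu>"
    by (simp add: S_def)
  have S': "S' n \<in> sets \<nu>" for n
  proof -
    have [measurable]: "countable (Q n)"
      by (simp add: Q_def)
    have "{p\<in>space \<nu>. fst p \<in> UNIV \<and> (\<exists>q\<in>Q n. snd p < q \<and> F q (fst p) \<le> c)} \<in> sets \<nu>"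
      by measurable
    then show ?thesis by (simp add: S'_def)
  qed
  have "S = (\<Union>n. S' n)"
    unfolding S_def S'_def Rats by auto
  moreover have "incseq S'"
    by (auto simp: incseq_def S'_def Q_def)
  ultimately have "emeasure \<nu> S = (SUP n. emeasure \<nu> (S' n))"
    using S' by (simp add: SUP_emeasure_incseq image_subset_iff)
  also have "\<dots> \<le> c"
  proof (rule SUP_least)
    fix n
    have "emeasure \<nu> (S' n) \<le> c * emeasure m UNIV"
      unfolding S'_def by (rule emeasure_finite_levels_le[OF F mass]) (auto simp: Q_def)
    then show "emeasure \<nu> (S' n) \<le> c"
      using base.emeasure_space_1 by simp
  qed
  finally have "emeasure \<nu> S \<noteq> 1"
    using \<open>c < 1\<close> by auto
  moreover have "emeasure \<nu> S = 0 \<or> emeasure \<nu> S = 1"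
  proof (rule ergodic_almost_invariant[OF \<nu> S])
    have "c < top"
      using \<open>c < 1\<close> by (rule order_less_trans) simp
    show "AE p in \<nu>. skewproduct \<sigma> f t p \<in> S \<longleftrightarrow> p \<in> S" for t
      unfolding S_def by (rule levels_almost_invariant) (use F mass \<open>c < top\<close> in auto)
  qed
  ultimately have "AE p in \<nu>. p \<notin> S"
    using S by (intro AE_not_in) (auto simp: null_sets_def)
  then show ?thesis
    by (rule AE_mp) (rule AE_I2, auto simp: S_def not_le)
qed

text \<open>
  As the level sets of all \<open>c < 1\<close> are null sets, \<open>F q \<omega> \<ge> 1\<close> for almost every \<open>(\<omega>, x)\<close> and all
  rational \<open>q > x\<close>. Conversely, where \<open>F q \<omega> \<ge> 1\<close>, almost all of the mass of the fibre is below
  \<open>q\<close>. So \<open>x\<close> is the infimum of the rational \<open>q\<close> with \<open>F q \<omega> \<ge> 1\<close>, which depends on \<open>\<omega>\<close> only.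
\<close>

lemma ergodic_measure_on_graph:
  "\<exists>b\<in>borel_measurable borel. AE p in \<nu>. snd p = b (fst p)"
proof -
  note countable_rat[measurable]
  obtain F where F[measurable]: "\<And>q. F q \<in> borel_measurable borel"
    and mass: "\<And>q A. A \<in> sets borel \<Longrightarrow>
      emeasure \<nu> {p\<in>K. snd p < q \<and> fst p \<in> A} = (\<integral>\<^sup>+\<omega>\<in>A. F q \<omega> \<partial>m)"
    using fibre_distribution_exists by blast
  define c where "c n = ennreal (1 - inverse (real (Suc n)))" for n
  have c1: "c n < 1" for n
    unfolding c_def by (subst ennreal_1[symmetric], subst ennreal_less_iff) (auto simp: field_simps)
  have c_dense: "1 \<le> z" if "\<And>n. c n < z" for z
  proof (rule ccontr)
    assume "\<not> 1 \<le> z"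
    then obtain y where y: "z = ennreal y" "0 \<le> y" "y < 1"
      by (cases z) (auto simp: not_le simp flip: ennreal_1)
    obtain n where "inverse (real (Suc n)) < 1 - y"
      using reals_Archimedean[of "1 - y"] y by auto
    then have "z \<le> c n"
      unfolding y c_def by (intro ennreal_leI) simp
    with that[of n] show False by simp
  qed
  have "AE p in \<nu>. \<forall>n. \<forall>q\<in>\<rat>. snd p < q \<longrightarrow> c n < F q (fst p)"
    unfolding AE_all_countable by (intro allI levels_null[OF F mass] c1)
  then have above: "AE p in \<nu>. \<forall>q\<in>\<rat>. snd p < q \<longrightarrow> 1 \<le> F q (fst p)"
    by eventually_elim (auto intro!: c_dense)
  have "AE p in \<nu>. 1 \<le> F q (fst p) \<longrightarrow> snd p < q" for q
  proof -
    define A where "A = {\<omega>. 1 \<le> F q \<omega>}"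
    have A[measurable]: "A \<in> sets borel"
      unfolding A_def by measurable
    have "{p\<in>space \<nu>. snd p < q \<and> fst p \<in> A} \<in> sets \<nu>" "{p\<in>space \<nu>. fst p \<in> A} \<in> sets \<nu>"
      by measurable
    moreover have "emeasure \<nu> {p\<in>K. fst p \<in> A} \<le> emeasure \<nu> {p\<in>K. snd p < q \<and> fst p \<in> A}"
    proof -
      have "emeasure m A = (\<integral>\<^sup>+\<omega>. indicator A \<omega> \<partial>m)"
        by simp
      also have "\<dots> \<le> (\<integral>\<^sup>+\<omega>\<in>A. F q \<omega> \<partial>m)"
        by (intro nn_integral_mono) (auto simp: A_def split: split_indicator)
      finally show ?thesis
        by (simp add: mass emeasure_fst)
    qed
    ultimately have "AE p in \<nu>. p \<in> {p\<in>K. snd p < q \<and> fst p \<in> A} \<longleftrightarrow> p \<in> {p\<in>K. fst p \<in> A}"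
      by (intro AE_iff_of_equal_emeasure) auto
    then show ?thesis
      by (rule AE_mp) (rule AE_I2, auto simp: A_def)
  qed
  then have below: "AE p in \<nu>. \<forall>q\<in>\<rat>. 1 \<le> F q (fst p) \<longrightarrow> snd p < q"
    by (intro AE_ball_countable[THEN iffD2] ballI countable_rat)
  \<comment> \<open>extended reals, because over a null set the infimum may be infinite\<close>
  define b where "b \<omega> = real_of_ereal (INF q\<in>\<rat>. if 1 \<le> F q \<omega> then ereal q else \<infinity>)" for \<omega>
  have "(\<lambda>\<omega>. INF q\<in>\<rat>. if 1 \<le> F q \<omega> then ereal q else \<infinity>) \<in> borel_measurable borel"
    by (intro borel_measurable_INF countable_rat) measurable
  then have "b \<in> borel_measurable borel"
    unfolding b_def by measurable
  moreover have "AE p in \<nu>. snd p = b (fst p)"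
    using above below
  proof eventually_elim
    case (elim p)
    have "(INF q\<in>\<rat>. if 1 \<le> F q (fst p) then ereal q else \<infinity>) = ereal (snd p)"
    proof (rule antisym)
      show "(INF q\<in>\<rat>. if 1 \<le> F q (fst p) then ereal q else \<infinity>) \<le> ereal (snd p)"
      proof (rule dense_ge)
        fix z assume "ereal (snd p) < z"
        then obtain r where r: "ereal (snd p) < ereal (real_of_rat r)" "ereal (real_of_rat r) < z"
          using ereal_dense3 by blast
        have "(INF q\<in>\<rat>. if 1 \<le> F q (fst p) then ereal q else \<infinity>)
            \<le> (if 1 \<le> F (real_of_rat r) (fst p) then ereal (real_of_rat r) else \<infinity>)"
          by (rule INF_lower) simp
        also have "\<dots> = ereal (real_of_rat r)"
          using elim(1) r(1) by auto
        finally show "(INF q\<in>\<rat>. if 1 \<le> F q (fst p) then ereal q else \<infinity>) \<le> z"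
          using r(2) by simp
      qed
      show "ereal (snd p) \<le> (INF q\<in>\<rat>. if 1 \<le> F q (fst p) then ereal q else \<infinity>)"
        using elim(2) by (intro INF_greatest) auto
    qed
    then show ?case
      by (simp add: b_def)
  qed
  ultimately show ?thesis by blast
qed

end

section \<open>Invariant sections\<close>

context ergodic_base
begin

definition invariant_section :: "('a \<Rightarrow> real) \<Rightarrow> bool" where
  "invariant_section b \<longleftrightarrow> b \<in> borel_measurable borel \<and>
     (\<forall>t. AE \<omega> in m. (\<omega>, b \<omega>) \<in> K \<and> u t \<omega> (b \<omega>) = b (\<sigma> t \<omega>))"

end

context projected_ergodic
begin

text \<open>
  The exceptional points lie in a measurable null set, whose complement can be pulled back to
  the base along the graph.
\<close>

lemma AE_graph:
  assumes b: "b \<in> borel_measurable borel" and graph: "AE p in \<nu>. snd p = b (fst p)"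
    and P: "AE p in \<nu>. P p"
  shows "AE \<omega> in m. (\<omega>, b \<omega>) \<in> K \<and> P (\<omega>, b \<omega>)"
proof -
  obtain N where N: "N \<in> sets \<nu>" "emeasure \<nu> N = 0" "{p\<in>space \<nu>. \<not> P p} \<subseteq> N"
    using P by (auto elim!: AE_E)
  have KN: "K - N \<in> sets borel"
  proof -
    have "N \<in> sets borel"
      using N(1) compact_K unfolding ergodic_sets[OF \<nu>] sets_restrict_space
      by (auto intro: borel_compact)
    then show ?thesis
      using compact_K by (auto intro: borel_compact)
  qed
  have "(\<lambda>\<omega>. (\<omega>, b \<omega>)) \<in> borel \<rightarrow>\<^sub>M borel"
    by (rule borel_measurable_Pair_second_countable_snd) (use b in auto)
  from measurable_sets[OF this KN] have M: "Measurable.pred borel (\<lambda>\<omega>. (\<omega>, b \<omega>) \<in> K - N)"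
    by (simp add: pred_def vimage_def)
  have "AE p in \<nu>. p \<notin> N"
    using N by (intro AE_not_in) (auto simp: null_sets_def)
  with graph AE_space[of \<nu>] have "AE p in \<nu>. (fst p, b (fst p)) \<in> K - N"
  proof eventually_elim
    case (elim p)
    then have "(fst p, b (fst p)) = p"
      by (simp add: prod_eq_iff)
    with elim show ?case by simp
  qed
  then have "AE \<omega> in m. (\<omega>, b \<omega>) \<in> K - N"
    using AE_fst_iff[OF M] by simp
  then show ?thesis
    by eventually_elim (use N(3) in auto)
qed

lemma emeasure_graph:
  assumes b: "b \<in> borel_measurable borel" and graph: "AE p in \<nu>. snd p = b (fst p)"
    and B: "B \<in> sets \<nu>"
  shows "{\<omega>. (\<omega>, b \<omega>) \<in> B} \<in> sets borel" "emeasure \<nu> B = emeasure m {\<omega>. (\<omega>, b \<omega>) \<in> B}"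
proof -
  have "B \<in> sets borel"
    using B compact_K unfolding ergodic_sets[OF \<nu>] sets_restrict_space
    by (auto intro: borel_compact)
  moreover have "(\<lambda>\<omega>. (\<omega>, b \<omega>)) \<in> borel \<rightarrow>\<^sub>M borel"
    by (rule borel_measurable_Pair_second_countable_snd) (use b in auto)
  ultimately show M: "{\<omega>. (\<omega>, b \<omega>) \<in> B} \<in> sets borel"
    using measurable_sets[of "\<lambda>\<omega>. (\<omega>, b \<omega>)" borel borel B] by (simp add: vimage_def)
  have "emeasure \<nu> B = emeasure \<nu> {p\<in>K. fst p \<in> {\<omega>. (\<omega>, b \<omega>) \<in> B}}"
  proof (rule emeasure_eq_AE)
    show "AE p in \<nu>. p \<in> B \<longleftrightarrow> p \<in> {p\<in>K. fst p \<in> {\<omega>. (\<omega>, b \<omega>) \<in> B}}"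
      using graph AE_space
    proof eventually_elim
      case (elim p)
      then have "(fst p, b (fst p)) = p"
        by (simp add: prod_eq_iff)
      with elim(2) show ?case by simp
    qed
    have "{p\<in>space \<nu>. fst p \<in> {\<omega>. (\<omega>, b \<omega>) \<in> B}} \<in> sets \<nu>"
      using M by measurable
    then show "{p\<in>K. fst p \<in> {\<omega>. (\<omega>, b \<omega>) \<in> B}} \<in> sets \<nu>"
      by simp
  qed (rule B)
  also have "\<dots> = emeasure m {\<omega>. (\<omega>, b \<omega>) \<in> B}"
    by (rule emeasure_fst[OF M])
  finally show "emeasure \<nu> B = emeasure m {\<omega>. (\<omega>, b \<omega>) \<in> B}" .
qed

lemma invariant_section_of_graph:
  assumes b: "b \<in> borel_measurable borel" and graph: "AE p in \<nu>. snd p = b (fst p)"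
  shows "invariant_section b"
proof -
  have "AE p in \<nu>. snd (skewproduct \<sigma> f t p) = b (fst (skewproduct \<sigma> f t p))" for t
    using AE_flow[OF \<nu> graph] .
  then have "AE \<omega> in m. (\<omega>, b \<omega>) \<in> K \<and>
      snd (skewproduct \<sigma> f t (\<omega>, b \<omega>)) = b (fst (skewproduct \<sigma> f t (\<omega>, b \<omega>)))" for t
    by (rule AE_graph[OF b graph])
  then show ?thesis
    using b by (simp add: invariant_section_def skewproduct_def)
qed

text \<open>
  The region on one side of an invariant section is almost invariant, since the flow preserves
  the order in the fibres; ergodicity then makes the order of two sections constant.
\<close>

lemma section_comparison:
  assumes b: "b \<in> borel_measurable borel" and graph: "AE p in \<nu>. snd p = b (fst p)"
    and b': "invariant_section b'"
  shows "(AE \<omega> in m. b \<omega> < b' \<omega>) \<or> (AE \<omega> in m. b' \<omega> < b \<omega>) \<or> (AE \<omega> in m. b \<omega> = b' \<omega>)"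
proof -
  have b'_m[measurable]: "b' \<in> borel_measurable borel"
    using b' by (simp add: invariant_section_def)
  define A where "A = {p\<in>K. snd p < b' (fst p)}"
  define A' where "A' = {p\<in>K. b' (fst p) < snd p}"
  have "{p\<in>space \<nu>. snd p < b' (fst p)} \<in> sets \<nu>" "{p\<in>space \<nu>. b' (fst p) < snd p} \<in> sets \<nu>"
    by measurable
  then have A: "A \<in> sets \<nu>" and A': "A' \<in> sets \<nu>"
    by (simp_all add: A_def A'_def)
  have inv: "AE p in \<nu>. (skewproduct \<sigma> f t p \<in> A \<longleftrightarrow> p \<in> A) \<and> (skewproduct \<sigma> f t p \<in> A' \<longleftrightarrow> p \<in> A')" for t
  proof -
    have "AE \<omega> in m. (\<omega>, b' \<omega>) \<in> K \<and> u t \<omega> (b' \<omega>) = b' (\<sigma> t \<omega>)"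
      using b' by (simp add: invariant_section_def)
    from AE_fst[OF this] AE_space show ?thesis
    proof eventually_elim
      case (elim p)
      obtain \<omega> x where p: "p = (\<omega>, x)"
        by (cases p)
      with elim have "(\<omega>, x) \<in> K" "(\<omega>, b' \<omega>) \<in> K" and eq: "u t \<omega> (b' \<omega>) = b' (\<sigma> t \<omega>)"
        by auto
      then have "u t \<omega> x < u t \<omega> (b' \<omega>) \<longleftrightarrow> x < b' \<omega>" "u t \<omega> (b' \<omega>) < u t \<omega> x \<longleftrightarrow> b' \<omega> < x"
        using u_strict_mono[of \<omega> x "b' \<omega>" t] u_strict_mono[of \<omega> "b' \<omega>" x t]
        by (metis less_irrefl linorder_neqE_linordered_idom order_less_asym')+
      then show ?case
        using \<open>(\<omega>, x) \<in> K\<close> by (simp add: p A_def A'_def skewproduct_def u_in eq)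
    qed
  qed
  have zero_one: "emeasure \<nu> A = 0 \<or> emeasure \<nu> A = 1" "emeasure \<nu> A' = 0 \<or> emeasure \<nu> A' = 1"
    by (rule ergodic_almost_invariant[OF \<nu>]; use A A' inv in simp)+
  have full: "AE p in \<nu>. p \<in> B" if "emeasure \<nu> B = 1" "B \<in> sets \<nu>" for B
    using that prob_eq_1[OF that(2)] by (simp add: emeasure_eq_measure)
  have null: "AE p in \<nu>. p \<notin> B" if "emeasure \<nu> B = 0" "B \<in> sets \<nu>" for B
    using that by (intro AE_not_in) (auto simp: null_sets_def)
  note graph_AE = AE_graph[OF b graph]
  from zero_one consider "emeasure \<nu> A = 1" | "emeasure \<nu> A' = 1" | "emeasure \<nu> A = 0" "emeasure \<nu> A' = 0"
    by auto
  then show ?thesis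
  proof cases
    case 1
    from graph_AE[OF full[OF 1 A]] have "AE \<omega> in m. b \<omega> < b' \<omega>"
      by eventually_elim (simp add: A_def)
    then show ?thesis by simp
  next
    case 2
    from graph_AE[OF full[OF 2 A']] have "AE \<omega> in m. b' \<omega> < b \<omega>"
      by eventually_elim (simp add: A'_def)
    then show ?thesis by simp
  next
    case 3
    from graph_AE[OF null[OF 3(1) A]] graph_AE[OF null[OF 3(2) A']] have "AE \<omega> in m. b \<omega> = b' \<omega>"
      by eventually_elim (auto simp: A_def A'_def)
    then show ?thesis by simp
  qed
qed

end

lemma (in ergodic_base) ergodic_measure_determined_by_graph:
  assumes "projected_ergodic \<sigma> f K m \<nu>" "projected_ergodic \<sigma> f K m \<nu>'"
    and b: "b \<in> borel_measurable borel" "AE p in \<nu>. snd p = b (fst p)"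
    and b': "b' \<in> borel_measurable borel" "AE p in \<nu>'. snd p = b' (fst p)"
    and eq: "AE \<omega> in m. b \<omega> = b' \<omega>"
  shows "\<nu> = \<nu>'"
proof -
  interpret N: projected_ergodic \<sigma> f K m \<nu> by fact
  interpret N': projected_ergodic \<sigma> f K m \<nu>' by fact
  show ?thesis
  proof (rule measure_eqI)
    show s: "sets \<nu> = sets \<nu>'"
      by (simp only: ergodic_sets[OF N.\<nu>] ergodic_sets[OF N'.\<nu>])
    fix B assume B: "B \<in> sets \<nu>"
    then have B': "B \<in> sets \<nu>'"
      by (simp add: s)
    have "emeasure m {\<omega>. (\<omega>, b \<omega>) \<in> B} = emeasure m {\<omega>. (\<omega>, b' \<omega>) \<in> B}"
      by (rule emeasure_eq_AE)
        (use eq N.emeasure_graph(1)[OF b B] N'.emeasure_graph(1)[OF b' B'] in auto)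
    then show "emeasure \<nu> B = emeasure \<nu>' B"
      by (simp only: N.emeasure_graph(2)[OF b B] N'.emeasure_graph(2)[OF b' B'])
  qed
qed

section \<open>The cross ratio of four ordered solutions\<close>

text \<open>
  The combination of slopes vanishes for quadratic polynomials \<open>g\<close>, and in general it is the
  third divided difference of \<open>g\<close> times \<open>(x3 - x2) * (x4 - x1)\<close>. Subtract from \<open>g\<close> the
  quadratic polynomial whose derivative is the chord of \<open>g'\<close> over \<open>{x2..x3}\<close>. Concavity of \<open>g'\<close>
  makes the difference increasing on \<open>{x2..x3}\<close> and decreasing on \<open>{x1..x2}\<close> and
  \<open>{x3..x4}\<close>, from where the sign can be read off.
\<close>

lemma slopes_of_concave_derivative:
  fixes g g' :: "real \<Rightarrow> real"
  assumes g: "\<And>x. (g has_real_derivative g' x) (at x)" and conc: "concave_on UNIV g'"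
    and x: "x1 < x2" "x2 < x3" "x3 < x4"
  defines "D \<equiv> (g x2 - g x1) / (x2 - x1) + (g x4 - g x3) / (x4 - x3)
    - (g x3 - g x1) / (x3 - x1) - (g x4 - g x2) / (x4 - x2)"
  shows "D \<le> 0"
    and "\<And>c h. x2 \<le> c - h \<Longrightarrow> 0 < h \<Longrightarrow> c + h \<le> x3 \<Longrightarrow> g' (c - h) + g' (c + h) < 2 * g' c \<Longrightarrow> D < 0"
proof -
  define s where "s = (g' x3 - g' x2) / (x3 - x2)"
  define chord where "chord x = g' x2 + s * (x - x2)" for x
  define k where "k x = g x - (g' x2 * x + s * (x - x2)\<^sup>2 / 2)" for x
  have dk: "(k has_real_derivative g' x - chord x) (at x)" for x
    unfolding k_def chord_def by (auto intro!: derivative_eq_intros g simp: field_simps)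
  have ends: "chord x2 = g' x2" "chord x3 = g' x3"
    using x by (auto simp: chord_def s_def)
  have chord_affine: "chord ((1 - a) * y + a * z) = (1 - a) * chord y + a * chord z" for a y z
    by (simp add: chord_def algebra_simps)
  have concD: "(1 - a) * g' y + a * g' z \<le> g' ((1 - a) * y + a * z)" if "0 \<le> a" "a \<le> 1" for a y z
    using concave_onD[OF conc that, of y z] by simp
  have inner: "chord y \<le> g' y" if "x2 \<le> y" "y \<le> x3" for y
  proof -
    define a where "a = (y - x2) / (x3 - x2)"
    have a: "0 \<le> a" "a \<le> 1"
      using that x by (auto simp: a_def field_simps)
    have "y = x2 + a * (x3 - x2)"
      using that x by (simp add: a_def)
    then have y: "y = (1 - a) * x2 + a * x3"
      by (simp add: algebra_simps)
    show ?thesis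
      using concD[OF a, of x2 x3] unfolding y chord_affine ends .
  qed
  have outer_left: "g' y \<le> chord y" if "y \<le> x2" for y
  proof -
    define a where "a = (x2 - y) / (x3 - y)"
    have a: "0 \<le> a" "a < 1"
      using that x by (auto simp: a_def field_simps)
    have "x2 = y + a * (x3 - y)"
      using that x by (simp add: a_def)
    then have y: "x2 = (1 - a) * y + a * x3"
      by (simp add: algebra_simps)
    have "(1 - a) * g' y + a * g' x3 \<le> g' x2"
      using concD[of a y x3] a by (simp add: y[symmetric])
    moreover have "(1 - a) * chord y + a * g' x3 = g' x2"
      using chord_affine[of a y x3] by (simp add: y[symmetric] ends)
    ultimately have "(1 - a) * g' y \<le> (1 - a) * chord y"
      by linarith
    then show ?thesis
      using a by simp
  qed
  have outer_right: "g' y \<le> chord y" if "x3 \<le> y" for y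
  proof -
    define a where "a = (x3 - x2) / (y - x2)"
    have a: "0 < a" "a \<le> 1"
      using that x by (auto simp: a_def field_simps)
    have "x3 = x2 + a * (y - x2)"
      using that x by (simp add: a_def)
    then have y: "x3 = (1 - a) * x2 + a * y"
      by (simp add: algebra_simps)
    have "(1 - a) * g' x2 + a * g' y \<le> g' x3"
      using concD[of a x2 y] a by (simp add: y[symmetric])
    moreover have "(1 - a) * g' x2 + a * chord y = g' x3"
      using chord_affine[of a x2 y] by (simp add: y[symmetric] ends)
    ultimately have "a * g' y \<le> a * chord y"
      by linarith
    then show ?thesis
      using a by simp
  qed
  have incr: "k y \<le> k z" if "x2 \<le> y" "y \<le> z" "z \<le> x3" for y z
    by (rule DERIV_nonneg_imp_nondecreasing[OF that(2)]) (use that inner dk in force)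
  have k12: "k x2 \<le> k x1"
    by (rule DERIV_nonpos_imp_nonincreasing) (use x outer_left dk in force)+
  have k34: "k x4 \<le> k x3"
    by (rule DERIV_nonpos_imp_nonincreasing) (use x outer_right dk in force)+
  have slope: "(g y - g z) / (y - z) = (k y - k z) / (y - z) + g' x2 + s * (y + z - 2 * x2) / 2"
    if "z < y" for y z
    using that by (simp add: k_def field_simps power2_eq_square)
  have D: "D = - ((k x1 - k x2) / (x2 - x1) - (k x1 - k x2) / (x3 - x1))
      - ((k x3 - k x4) / (x4 - x3) - (k x3 - k x4) / (x4 - x2))
      - (k x3 - k x2) / (x3 - x1) - (k x3 - k x2) / (x4 - x2)"
  proof -
    have "x1 < x3" "x2 < x4"
      using x by auto
    then show ?thesis
      unfolding D_def slope[OF x(1)] slope[OF x(3)] slope[OF \<open>x1 < x3\<close>] slope[OF \<open>x2 < x4\<close>]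
      by (simp add: diff_divide_distrib add_divide_distrib algebra_simps)
  qed
  have "(k x1 - k x2) / (x3 - x1) \<le> (k x1 - k x2) / (x2 - x1)"
    "(k x3 - k x4) / (x4 - x2) \<le> (k x3 - k x4) / (x4 - x3)"
    using x k12 k34 by (auto intro!: divide_left_mono)
  then have D_le: "D \<le> - ((k x3 - k x2) / (x3 - x1)) - (k x3 - k x2) / (x4 - x2)"
    unfolding D by simp
  moreover have "0 \<le> (k x3 - k x2) / (x3 - x1)" "0 \<le> (k x3 - k x2) / (x4 - x2)"
    using x incr[of x2 x3] by auto
  ultimately show "D \<le> 0"
    by linarith
  fix c h
  assume ch: "x2 \<le> c - h" "0 < h" "c + h \<le> x3" and strict: "g' (c - h) + g' (c + h) < 2 * g' c"
  have "2 * chord c = chord (c - h) + chord (c + h)"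
    by (simp add: chord_def algebra_simps)
  then have "0 < g' c - chord c"
    using strict inner[of "c - h"] inner[of "c + h"] ch by simp
  from DERIV_pos_inc_right[OF dk this] obtain d where d: "d > 0" "\<And>e. 0 < e \<Longrightarrow> e < d \<Longrightarrow> k c < k (c + e)"
    by auto
  define e where "e = min (d / 2) h"
  have "k x2 \<le> k c" "k (c + e) \<le> k x3"
    using ch d(1) by (auto intro!: incr simp: e_def)
  moreover have "k c < k (c + e)"
    using d ch by (auto simp: e_def)
  ultimately have "0 < (k x3 - k x2) / (x3 - x1)" "0 < (k x3 - k x2) / (x4 - x2)"
    using x by auto
  with D_le show "D < 0"
    by linarith
qed

definition cross_ratio :: "real \<Rightarrow> real \<Rightarrow> real \<Rightarrow> real \<Rightarrow> real" where
  "cross_ratio x1 x2 x3 x4 = (x2 - x1) * (x4 - x3) / ((x3 - x1) * (x4 - x2))"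

lemma ln_cross_ratio:
  assumes "x1 < x2" "x2 < x3" "x3 < x4"
  shows "ln (cross_ratio x1 x2 x3 x4) = ln (x2 - x1) + ln (x4 - x3) - ln (x3 - x1) - ln (x4 - x2)"
    and "0 < cross_ratio x1 x2 x3 x4"
  using assms by (simp_all add: cross_ratio_def ln_mult ln_div)

context invariant_compact
begin

text \<open>
  The derivative of the logarithm of the cross ratio along the flow is the combination of
  slopes from \<open>slopes_of_concave_derivative\<close>, for \<open>g = f (\<sigma> t \<omega>)\<close> at the four solutions. A
  negative derivative at time \<open>0\<close> is enough for a strict decrease up to time \<open>1\<close>.
\<close>

lemma cross_ratio_decreases:
  assumes dc: "DC f"
    and K: "(\<omega>, x1) \<in> K" "(\<omega>, x2) \<in> K" "(\<omega>, x3) \<in> K" "(\<omega>, x4) \<in> K"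
    and x: "x1 < x2" "x2 < x3" "x3 < x4"
  defines "R0 \<equiv> cross_ratio x1 x2 x3 x4"
    and "R1 \<equiv> cross_ratio (u 1 \<omega> x1) (u 1 \<omega> x2) (u 1 \<omega> x3) (u 1 \<omega> x4)"
  shows "R1 \<le> R0"
    and "\<And>c h. x2 \<le> c - h \<Longrightarrow> 0 < h \<Longrightarrow> c + h \<le> x3 \<Longrightarrow>
      deriv (f \<omega>) (c - h) + deriv (f \<omega>) (c + h) < 2 * deriv (f \<omega>) c \<Longrightarrow> R1 < R0"
proof -
  define H where "H t = ln (cross_ratio (u t \<omega> x1) (u t \<omega> x2) (u t \<omega> x3) (u t \<omega> x4))" for t
  define D where "D t = (f (\<sigma> t \<omega>) (u t \<omega> x2) - f (\<sigma> t \<omega>) (u t \<omega> x1)) / (u t \<omega> x2 - u t \<omega> x1)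
    + (f (\<sigma> t \<omega>) (u t \<omega> x4) - f (\<sigma> t \<omega>) (u t \<omega> x3)) / (u t \<omega> x4 - u t \<omega> x3)
    - (f (\<sigma> t \<omega>) (u t \<omega> x3) - f (\<sigma> t \<omega>) (u t \<omega> x1)) / (u t \<omega> x3 - u t \<omega> x1)
    - (f (\<sigma> t \<omega>) (u t \<omega> x4) - f (\<sigma> t \<omega>) (u t \<omega> x2)) / (u t \<omega> x4 - u t \<omega> x2)" for t
  have ord: "u t \<omega> x1 < u t \<omega> x2" "u t \<omega> x2 < u t \<omega> x3" "u t \<omega> x3 < u t \<omega> x4" for t
    using K x by (auto intro: u_strict_mono)
  have conc: "concave_on UNIV (deriv (f \<eta>))" for \<eta>
    using dc by (simp add: DC_def)
  have H_eq: "H = (\<lambda>t. ln (u t \<omega> x2 - u t \<omega> x1) + ln (u t \<omega> x4 - u t \<omega> x3)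
      - ln (u t \<omega> x3 - u t \<omega> x1) - ln (u t \<omega> x4 - u t \<omega> x2))"
    unfolding H_def using ord by (simp add: ln_cross_ratio)
  have dln: "((\<lambda>t. ln (u t \<omega> y - u t \<omega> z)) has_real_derivative
      (f (\<sigma> t \<omega>) (u t \<omega> y) - f (\<sigma> t \<omega>) (u t \<omega> z)) / (u t \<omega> y - u t \<omega> z)) (at t)"
    if "(\<omega>, y) \<in> K" "(\<omega>, z) \<in> K" "u t \<omega> z < u t \<omega> y" for y z t
    using that by (auto intro!: derivative_eq_intros u_deriv)
  have dH: "(H has_real_derivative D t) (at t)" for t
    unfolding H_eq D_def using ord[of t] K by (intro derivative_intros dln) auto
  have D_le: "D t \<le> 0" for t
    unfolding D_def by (rule slopes_of_concave_derivative(1)[OF df conc ord])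
  have H_mono: "H t \<le> H s" if "s \<le> t" for s t
    by (rule DERIV_nonpos_imp_nonincreasing[OF that]) (use dH D_le in blast)
  have H01: "H 0 = ln R0" "H 1 = ln R1"
    using K by (simp_all add: H_def R0_def R1_def u_zero)
  have pos: "0 < R0" "0 < R1"
    using ln_cross_ratio(2)[OF x] ln_cross_ratio(2)[OF ord[of 1]] by (auto simp: R0_def R1_def)
  show "R1 \<le> R0"
    using H_mono[of 0 1] pos by (simp add: H01)
  fix c h
  assume "x2 \<le> c - h" "0 < h" "c + h \<le> x3"
    "deriv (f \<omega>) (c - h) + deriv (f \<omega>) (c + h) < 2 * deriv (f \<omega>) c"
  then have "D 0 < 0"
    unfolding D_def using K x
    by (simp only: u_zero base_zero) (rule slopes_of_concave_derivative(2)[OF df conc])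
  from DERIV_neg_dec_right[OF dH this] obtain d where d: "d > 0" "\<And>e. 0 < e \<Longrightarrow> e < d \<Longrightarrow> H (0 + e) < H 0"
    by auto
  have "H 1 \<le> H (min 1 (d / 2))"
    by (rule H_mono) simp
  also have "\<dots> < H 0"
    using d(2)[of "min 1 (d / 2)"] d(1) by simp
  finally show "R1 < R0"
    using pos by (simp add: H01)
qed

lemma strict_midpoint_of_module:
  assumes dc: "DC f" and module: "dconcavity_module f (variation_interval K) \<epsilon> \<omega> > 0"
    and "\<epsilon> > 0" and K: "(\<omega>, x2) \<in> K" "(\<omega>, x3) \<in> K" and gap: "\<epsilon> \<le> x3 - x2"
  defines "c \<equiv> (x2 + x3) / 2"
  shows "deriv (f \<omega>) (c - \<epsilon> / 2) + deriv (f \<omega>) (c + \<epsilon> / 2) < 2 * deriv (f \<omega>) c"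
proof -
  let ?J = "variation_interval K"
  let ?\<phi> = "\<lambda>x. 2 * deriv (f \<omega>) x - deriv (f \<omega>) (x - \<epsilon> / 2) - deriv (f \<omega>) (x + \<epsilon> / 2)"
  have bdd: "bdd_above (snd ` K)" "bdd_below (snd ` K)"
    using compact_imp_bounded[OF compact_continuous_image[OF continuous_on_snd[OF continuous_on_id] compact_K]]
    by (auto intro: bounded_imp_bdd_above bounded_imp_bdd_below)
  have J: "x2 \<in> ?J" "x3 \<in> ?J"
    using K bdd by (force simp: variation_interval_def intro: cInf_lower cSup_upper)+
  have c: "c \<in> shrunk_interval ?J \<epsilon>"
    using J gap by (auto simp: shrunk_interval_def variation_interval_def c_def field_simps)
  have "0 \<le> ?\<phi> x" for x
  proof -
    have "concave_on UNIV (deriv (f \<omega>))"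
      using dc by (simp add: DC_def)
    from concave_onD[OF this, of "1/2" "x - \<epsilon> / 2" "x + \<epsilon> / 2"] show ?thesis
      by (simp add: field_simps)
  qed
  then have "bdd_below (?\<phi> ` shrunk_interval ?J \<epsilon>)"
    by (intro bdd_belowI2)
  then have "(INF x\<in>shrunk_interval ?J \<epsilon>. ?\<phi> x) \<le> ?\<phi> c"
    using c by (rule cINF_lower)
  moreover have "0 < (INF x\<in>shrunk_interval ?J \<epsilon>. ?\<phi> x)"
  proof -
    have pos: "0 < y" if "0 < a * y" "0 \<le> a" for a y :: real
      using that by (auto simp: zero_less_mult_iff)
    show ?thesis
      by (rule pos[OF module[unfolded dconcavity_module_def]]) (use \<open>\<epsilon> > 0\<close> in simp)
  qed
  ultimately show ?thesis by simp
qed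

end

section \<open>Four ordered invariant sections\<close>

context ergodic_base
begin

text \<open>
  The cross ratio \<open>R\<close> of the sections satisfies \<open>R (\<sigma> 1 \<omega>) \<le> R \<omega>\<close>. Invariance of \<open>m\<close> turns this
  into an equality almost everywhere, which by \<open>cross_ratio_decreases\<close> forces the gap
  \<open>b3 - b2\<close> to be less than \<open>\<epsilon>\<close> almost everywhere on the set where the \<open>\<epsilon>\<close>-module is positive. As \<open>\<rho>\<close>
  is the same for all \<open>\<epsilon>\<close>, the gap would be less than every \<open>\<epsilon>\<close> on a set of measure at least \<open>\<rho>\<close>.
\<close>

lemma no_four_ordered_invariant_sections:
  assumes sdc: "SDC m f (variation_interval K)"
    and nontrivial: "0 < interval_length (variation_interval K)"
    and sec: "invariant_section b1" "invariant_section b2" "invariant_section b3" "invariant_section b4"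
    and ord: "AE \<omega> in m. b1 \<omega> < b2 \<omega>" "AE \<omega> in m. b2 \<omega> < b3 \<omega>" "AE \<omega> in m. b3 \<omega> < b4 \<omega>"
  shows False
proof -
  let ?J = "variation_interval K"
  have dc: "DC f"
    using sdc by (simp add: SDC_def)
  obtain \<rho> where \<rho>: "\<rho> > 0"
    "\<And>\<epsilon>. 0 < \<epsilon> \<Longrightarrow> \<epsilon> \<le> interval_length ?J / 2 \<Longrightarrow> measure m {\<omega>. dconcavity_module f ?J \<epsilon> \<omega> > 0} > \<rho>"
    using sdc by (auto simp: SDC_def)
  have [measurable]: "b1 \<in> borel_measurable borel" "b2 \<in> borel_measurable borel"
    "b3 \<in> borel_measurable borel" "b4 \<in> borel_measurable borel"
    using sec by (auto simp: invariant_section_def)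
  define R where "R \<omega> = cross_ratio (b1 \<omega>) (b2 \<omega>) (b3 \<omega>) (b4 \<omega>)" for \<omega>
  have [measurable]: "R \<in> borel_measurable borel"
    unfolding R_def cross_ratio_def by measurable
  have good: "AE \<omega> in m. (\<omega>, b1 \<omega>) \<in> K \<and> (\<omega>, b2 \<omega>) \<in> K \<and> (\<omega>, b3 \<omega>) \<in> K \<and> (\<omega>, b4 \<omega>) \<in> K \<and>
      b1 \<omega> < b2 \<omega> \<and> b2 \<omega> < b3 \<omega> \<and> b3 \<omega> < b4 \<omega> \<and>
      R (\<sigma> 1 \<omega>) = cross_ratio (u 1 \<omega> (b1 \<omega>)) (u 1 \<omega> (b2 \<omega>)) (u 1 \<omega> (b3 \<omega>)) (u 1 \<omega> (b4 \<omega>))"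
  proof -
    have "AE \<omega> in m. (\<omega>, b \<omega>) \<in> K \<and> u 1 \<omega> (b \<omega>) = b (\<sigma> 1 \<omega>)" if "invariant_section b" for b
      using that by (simp add: invariant_section_def)
    from this[OF sec(1)] this[OF sec(2)] this[OF sec(3)] this[OF sec(4)] ord show ?thesis
      by eventually_elim (simp add: R_def)
  qed
  then have decr: "AE \<omega> in m. R (\<sigma> 1 \<omega>) \<le> R \<omega>"
    by eventually_elim (auto simp: R_def intro!: cross_ratio_decreases(1)[OF dc])
  have "AE \<omega> in m. c < R (\<sigma> 1 \<omega>) \<longleftrightarrow> c < R \<omega>" for c
  proof -
    \<comment> \<open>the first set is the preimage of the second one and almost contained in it\<close>
    have "AE \<omega> in m. \<omega> \<in> {\<omega>. c < R (\<sigma> 1 \<omega>)} \<longleftrightarrow> \<omega> \<in> {\<omega>. c < R \<omega>}"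
    proof (rule base.AE_iff_of_equal_emeasure)
      show "AE \<omega> in m. \<omega> \<in> {\<omega>. c < R (\<sigma> 1 \<omega>)} \<longrightarrow> \<omega> \<in> {\<omega>. c < R \<omega>}"
        using decr by eventually_elim auto
      have M: "{\<omega>. c < R \<omega>} \<in> sets borel" "{\<omega>. c < R (\<sigma> 1 \<omega>)} \<in> sets borel"
        by measurable
      then show "{\<omega>. c < R (\<sigma> 1 \<omega>)} \<in> sets m" "{\<omega>. c < R \<omega>} \<in> sets m"
        by simp_all
      show "emeasure m {\<omega>. c < R \<omega>} \<le> emeasure m {\<omega>. c < R (\<sigma> 1 \<omega>)}"
        using emeasure_base_flow[OF M(1), of 1] by (simp add: vimage_def)
    qed
    then show ?thesis by simp
  qed
  then have "AE \<omega> in m. \<forall>c\<in>\<rat>. c < R (\<sigma> 1 \<omega>) \<longleftrightarrow> c < R \<omega>"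
    by (intro AE_ball_countable[THEN iffD2] ballI countable_rat)
  then have const: "AE \<omega> in m. R \<omega> \<le> R (\<sigma> 1 \<omega>)"
    by eventually_elim (meson Rats_dense_in_real less_le_not_le linorder_not_le)
  have gap_le: "\<rho> < measure m {\<omega>. b3 \<omega> - b2 \<omega> < \<epsilon>}" if \<epsilon>: "0 < \<epsilon>" "\<epsilon> \<le> interval_length ?J / 2" for \<epsilon>
  proof -
    have "AE \<omega> in m. \<omega> \<in> {\<omega>. dconcavity_module f ?J \<epsilon> \<omega> > 0} \<longrightarrow> \<omega> \<in> {\<omega>. b3 \<omega> - b2 \<omega> < \<epsilon>}"
      using good const
    proof eventually_elim
      case (elim \<omega>)
      show ?case
      proof (intro impI, rule ccontr)
        assume "\<omega> \<in> {\<omega>. dconcavity_module f ?J \<epsilon> \<omega> > 0}" "\<omega> \<notin> {\<omega>. b3 \<omega> - b2 \<omega> < \<epsilon>}"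
        then have module: "dconcavity_module f ?J \<epsilon> \<omega> > 0" and gap: "\<epsilon> \<le> b3 \<omega> - b2 \<omega>"
          by auto
        let ?c = "(b2 \<omega> + b3 \<omega>) / 2"
        have "cross_ratio (u 1 \<omega> (b1 \<omega>)) (u 1 \<omega> (b2 \<omega>)) (u 1 \<omega> (b3 \<omega>)) (u 1 \<omega> (b4 \<omega>))
            < cross_ratio (b1 \<omega>) (b2 \<omega>) (b3 \<omega>) (b4 \<omega>)"
        proof (rule cross_ratio_decreases(2)[OF dc])
          show "b2 \<omega> \<le> ?c - \<epsilon> / 2" "0 < \<epsilon> / 2" "?c + \<epsilon> / 2 \<le> b3 \<omega>"
            using gap \<epsilon>(1) by (simp_all add: field_simps)
          show "deriv (f \<omega>) (?c - \<epsilon> / 2) + deriv (f \<omega>) (?c + \<epsilon> / 2) < 2 * deriv (f \<omega>) ?c"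
            by (rule strict_midpoint_of_module[OF dc module \<epsilon>(1) _ _ gap]) (use elim in auto)
        qed (use elim in auto)
        then have "R (\<sigma> 1 \<omega>) < R \<omega>"
          using elim by (simp add: R_def[of \<omega>])
        with elim show False by simp
      qed
    qed
    moreover have "{\<omega>. b3 \<omega> - b2 \<omega> < \<epsilon>} \<in> sets m"
      by simp
    ultimately have "measure m {\<omega>. dconcavity_module f ?J \<epsilon> \<omega> > 0} \<le> measure m {\<omega>. b3 \<omega> - b2 \<omega> < \<epsilon>}"
      by (rule base.finite_measure_mono_AE)
    with \<rho>(2)[OF \<epsilon>] show ?thesis by simp
  qed
  define \<epsilon> where "\<epsilon> n = interval_length ?J / 2 * inverse (real (Suc n))" for n
  have \<epsilon>: "0 < \<epsilon> n" "\<epsilon> n \<le> interval_length ?J / 2" for n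
    using nontrivial by (auto simp: \<epsilon>_def field_simps)
  have \<epsilon>_lim: "\<epsilon> \<longlonglongrightarrow> 0"
    unfolding \<epsilon>_def using tendsto_mult_right_zero[OF LIMSEQ_inverse_real_of_nat] by simp
  define G where "G n = {\<omega>. b3 \<omega> - b2 \<omega> < \<epsilon> n}" for n
  have "(\<lambda>n. measure m (G n)) \<longlonglongrightarrow> measure m (\<Inter>n. G n)"
  proof (rule base.finite_Lim_measure_decseq)
    show "range G \<subseteq> sets m"
      by (auto simp: G_def)
    show "decseq G"
      unfolding decseq_def G_def
    proof (intro allI impI subsetI CollectI)
      fix i j \<omega> assume "i \<le> j" "\<omega> \<in> {\<omega>. b3 \<omega> - b2 \<omega> < \<epsilon> j}"
      moreover have "\<epsilon> j \<le> \<epsilon> i"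
        unfolding \<epsilon>_def using nontrivial \<open>i \<le> j\<close> by (intro mult_left_mono le_imp_inverse_le) auto
      ultimately show "b3 \<omega> - b2 \<omega> < \<epsilon> i" by simp
    qed
  qed
  moreover have "measure m (\<Inter>n. G n) = 0"
  proof -
    have "AE \<omega> in m. \<omega> \<notin> (\<Inter>n. G n)"
      using ord(2)
    proof eventually_elim
      case (elim \<omega>)
      obtain n where "\<epsilon> n < b3 \<omega> - b2 \<omega>"
        using order_tendstoD(2)[OF \<epsilon>_lim, of "b3 \<omega> - b2 \<omega>"] elim
        by (auto simp: eventually_sequentially)
      then have "\<omega> \<notin> G n"
        by (simp add: G_def)
      then show ?case by blast
    qed
    moreover have "(\<Inter>n. G n) \<in> sets m"
      by (intro sets.countable_INT) (auto simp: G_def)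
    ultimately show ?thesis
      by (subst base.prob_eq_0)
  qed
  ultimately have "(\<lambda>n. measure m (G n)) \<longlonglongrightarrow> 0"
    by simp
  from order_tendstoD(2)[OF this \<rho>(1)] obtain n where "measure m (G n) < \<rho>"
    by (auto simp: eventually_sequentially)
  with gap_le[OF \<epsilon>, of n] show False
    by (simp add: G_def)
qed

end

lemma four_increasing_elements:
  fixes V :: "'b::linorder set"
  assumes "card V = 4"
  obtains v1 v2 v3 v4 where "v1 \<in> V" "v2 \<in> V" "v3 \<in> V" "v4 \<in> V" "v1 < v2" "v2 < v3" "v3 < v4"
proof -
  have fin: "finite V"
    using assms by (intro card_ge_0_finite) simp
  obtain v1 v2 v3 v4 where "sorted_list_of_set V = [v1, v2, v3, v4]"
  proof -
    have "length (sorted_list_of_set V) = Suc (Suc (Suc (Suc 0)))"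
      using assms by simp
    then show thesis
      unfolding length_Suc_conv by (auto intro: that)
  qed
  moreover from this have "V = {v1, v2, v3, v4}"
    using set_sorted_list_of_set[OF fin] by simp
  ultimately show thesis
    using strict_sorted_list_of_set[of V] by (intro that[of v1 v2 v3 v4]) auto
qed

theorem theorem4p1:
  fixes \<sigma> :: "real \<Rightarrow> 'a::metric_space \<Rightarrow> 'a"
    and f :: "'a \<Rightarrow> real \<Rightarrow> real"
    and m :: "'a measure"
    and K :: "('a \<times> real) set"
  assumes "compact (UNIV :: 'a set)"
    and "continuous_flow \<sigma>"
    and "C0k 1 f"
    and "m \<in> ergodic_measures UNIV \<sigma>"
    and "compact K"
    and "skewproduct_invariant \<sigma> f K"
    and "fst ` K = UNIV"
    and "\<not> (\<exists>x. variation_interval K = {x})"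
    and "SDC m f (variation_interval K)"
  shows "finite {\<nu> \<in> ergodic_measures K (skewproduct \<sigma> f). projects_onto K \<nu> m} \<and>
         card {\<nu> \<in> ergodic_measures K (skewproduct \<sigma> f). projects_onto K \<nu> m} \<le> 3"
proof (rule ccontr)
  let ?M = "{\<nu> \<in> ergodic_measures K (skewproduct \<sigma> f). projects_onto K \<nu> m}"
  interpret ergodic_base \<sigma> f K m
    by unfold_locales fact+
  have PE: "projected_ergodic \<sigma> f K m \<nu>" if "\<nu> \<in> ?M" for \<nu>
    by unfold_locales (use that in auto)
  have "K \<noteq> {}"
    using assms(7) by auto
  have nontrivial: "0 < interval_length (variation_interval K)"
  proof -
    have "bounded (snd ` K)"
      by (intro compact_imp_bounded compact_continuous_image continuous_intros compact_K)
    then have "Inf (snd ` K) \<le> Sup (snd ` K)"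
      using \<open>K \<noteq> {}\<close> by (intro cInf_le_cSup) (auto intro: bounded_imp_bdd_above bounded_imp_bdd_below)
    moreover have "Inf (snd ` K) \<noteq> Sup (snd ` K)"
      using assms(8) by (auto simp: variation_interval_def)
    ultimately show ?thesis
      by (simp add: variation_interval_def)
  qed
  assume many: "\<not> (finite ?M \<and> card ?M \<le> 3)"
  then have "\<exists>T. T \<subseteq> ?M \<and> finite T \<and> card T = 4"
  proof (cases "finite ?M")
    case True
    with many have "4 \<le> card ?M" by simp
    then show ?thesis
      by (rule obtain_subset_with_card_n) auto
  next
    case False
    then show ?thesis
      using infinite_arbitrarily_large[of ?M 4] by auto
  qed
  then obtain T where T: "T \<subseteq> ?M" "finite T" "card T = 4"
    by blast
  have PT: "projected_ergodic \<sigma> f K m \<nu>" if "\<nu> \<in> T" for \<nu>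
    using PE T(1) that by blast
  have "\<forall>\<nu>\<in>T. \<exists>b. b \<in> borel_measurable borel \<and> (AE p in \<nu>. snd p = b (fst p))"
    using projected_ergodic.ergodic_measure_on_graph[OF PT] by blast
  from bchoice[OF this] obtain b
    where "\<forall>\<nu>\<in>T. b \<nu> \<in> borel_measurable borel \<and> (AE p in \<nu>. snd p = b \<nu> (fst p))"
    by blast
  then have b: "b \<nu> \<in> borel_measurable borel" "AE p in \<nu>. snd p = b \<nu> (fst p)" if "\<nu> \<in> T" for \<nu>
    using that by simp_all
  have sec: "invariant_section (b \<nu>)" if "\<nu> \<in> T" for \<nu>
    by (rule projected_ergodic.invariant_section_of_graph[OF PT b]) (rule that)+
  define below where "below \<nu> \<nu>' \<longleftrightarrow> (AE \<omega> in m. b \<nu> \<omega> < b \<nu>' \<omega>)" for \<nu> \<nu>'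
  have total: "below \<nu> \<nu>' \<or> below \<nu>' \<nu>" if \<nu>: "\<nu> \<in> T" "\<nu>' \<in> T" "\<nu> \<noteq> \<nu>'" for \<nu> \<nu>'
  proof -
    have "\<not> (AE \<omega> in m. b \<nu> \<omega> = b \<nu>' \<omega>)"
      using ergodic_measure_determined_by_graph[OF PT[OF \<nu>(1)] PT[OF \<nu>(2)]
          b(1,2)[OF \<nu>(1)] b(1,2)[OF \<nu>(2)]] \<nu>(3) by blast
    then show ?thesis
      using projected_ergodic.section_comparison[OF PT[OF \<nu>(1)] b(1,2)[OF \<nu>(1)] sec[OF \<nu>(2)]]
      unfolding below_def by blast
  qed
  \<comment> \<open>the order over one typical base point determines the order over almost every base point\<close>
  have "AE \<omega> in m. \<forall>\<nu>\<in>T. \<forall>\<nu>'\<in>T. below \<nu> \<nu>' \<longrightarrow> b \<nu> \<omega> < b \<nu>' \<omega>"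
    by (intro AE_finite_allI T(2) ballI) (auto simp: below_def)
  then obtain \<omega> where \<omega>: "\<And>\<nu> \<nu>'. \<nu> \<in> T \<Longrightarrow> \<nu>' \<in> T \<Longrightarrow> below \<nu> \<nu>' \<Longrightarrow> b \<nu> \<omega> < b \<nu>' \<omega>"
    using eventually_happens'[OF base.ae_filter_bot] by blast
  have order: "below \<nu> \<nu>'" if "\<nu> \<in> T" "\<nu>' \<in> T" "b \<nu> \<omega> < b \<nu>' \<omega>" for \<nu> \<nu>'
    using total[OF that(1,2)] \<omega>[OF that(2,1)] that(3) by (metis less_asym less_irrefl)
  have "inj_on (\<lambda>\<nu>. b \<nu> \<omega>) T"
  proof (rule inj_onI, rule ccontr)
    fix \<nu> \<nu>' assume "\<nu> \<in> T" "\<nu>' \<in> T" "b \<nu> \<omega> = b \<nu>' \<omega>" "\<nu> \<noteq> \<nu>'"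
    then show False
      using total[of \<nu> \<nu>'] \<omega>[of \<nu> \<nu>'] \<omega>[of \<nu>' \<nu>] by (metis less_irrefl)
  qed
  then have "card ((\<lambda>\<nu>. b \<nu> \<omega>) ` T) = 4"
    using T(3) by (simp add: card_image)
  from four_increasing_elements[OF this] obtain v1 v2 v3 v4
    where v: "v1 \<in> (\<lambda>\<nu>. b \<nu> \<omega>) ` T" "v2 \<in> (\<lambda>\<nu>. b \<nu> \<omega>) ` T"
      "v3 \<in> (\<lambda>\<nu>. b \<nu> \<omega>) ` T" "v4 \<in> (\<lambda>\<nu>. b \<nu> \<omega>) ` T" "v1 < v2" "v2 < v3" "v3 < v4" .
  from v(1-4) obtain \<nu>1 \<nu>2 \<nu>3 \<nu>4 where \<nu>: "\<nu>1 \<in> T" "\<nu>2 \<in> T" "\<nu>3 \<in> T" "\<nu>4 \<in> T"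
    and "v1 = b \<nu>1 \<omega>" "v2 = b \<nu>2 \<omega>" "v3 = b \<nu>3 \<omega>" "v4 = b \<nu>4 \<omega>"
    by blast
  with v(5-7) have "below \<nu>1 \<nu>2" "below \<nu>2 \<nu>3" "below \<nu>3 \<nu>4"
    by (simp_all add: order)
  then show False
    unfolding below_def
    by (rule no_four_ordered_invariant_sections[OF assms(9) nontrivial
        sec[OF \<nu>(1)] sec[OF \<nu>(2)] sec[OF \<nu>(3)] sec[OF \<nu>(4)]])
qed

end
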